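(* Let $H$ be a Hénon map in $\mathbb{C}^2$ and let $c>0$. If $F$ is a polynomial automorphism of $\mathbb{C}^2$ which acts as an automorphism of $\Omega_{H,c}$ (that is, $F(\Omega_{H,c})=\Omega_{H,c}$), then $F$ is an affine automorphism of the form $$(x,y)\mapsto (ax+by+f,\ dy+g)$$ for some $a,b,d,f,g\in\mathbb{C}$.
   Context: A Hénon map is a polynomial automorphism of $\mathbb{C}^2$ of the form $H=H_k\circ H_{k-1}\circ\cdots\circ H_1$ ($k\ge 1$), where $H_j(x,y)=(y,\ p_j(y)-\delta_j x)$ with $p_j$ a complex polynomial of degree $d_j\geq 2$ and $0\neq\delta_j\in\mathbb{C}$. The degree of $H$ is $d_H=d_1d_2\cdots d_k$. The Green function of $H$ is $G_H^{+}(x,y)=\lim_{n\to\infty}\frac{1}{d_H^{\,n}}\log^+\|H^{n}(x,y)\|$ for $(x,y)\in\mathbb{C}^2$, where $\log^+ t=\max\{\log t,0\}$ and $H^n$ is the $n$-fold iterate (the limit exists and is continuous on $\mathbb{C}^2$). For $c>0$, $\Omega_{H,c}=\{(x,y)\in\mathbb{C}^2: G_H^+(x,y)<c\}$. A polynomial automorphism of $\mathbb{C}^2$ is a bijective polynomial map with polynomial inverse. *)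

theory Defs
  imports "HOL-Analysis.Analysis" "HOL-Computational_Algebra.Polynomial"
begin

text \<open>
  \<open>\<complex>\<^sup>2\<close> is the type \<open>complex \<times> complex\<close>, whose library norm is the Euclidean one.
  An element of \<open>complex poly poly\<close> is read as a polynomial in \<open>y\<close> with coefficients in
  \<open>\<complex>[x]\<close>: \<open>poly P [:y:]\<close> substitutes the constant \<open>y\<close>, leaving an element of \<open>\<complex>[x]\<close>.
\<close>

definition polynomial_function2 :: "(complex \<times> complex \<Rightarrow> complex) \<Rightarrow> bool" where
  "polynomial_function2 f \<longleftrightarrow>
     (\<exists>P :: complex poly poly. \<forall>x y. f (x, y) = poly (poly P [:y:]) x)"

definition polynomial_map2 :: "(complex \<times> complex \<Rightarrow> complex \<times> complex) \<Rightarrow> bool" where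
  "polynomial_map2 F \<longleftrightarrow> polynomial_function2 (fst \<circ> F) \<and> polynomial_function2 (snd \<circ> F)"

definition polynomial_automorphism2 :: "(complex \<times> complex \<Rightarrow> complex \<times> complex) \<Rightarrow> bool" where
  "polynomial_automorphism2 F \<longleftrightarrow> bij F \<and> polynomial_map2 F \<and> polynomial_map2 (inv F)"

definition affine_automorphism2 :: "(complex \<times> complex \<Rightarrow> complex \<times> complex) \<Rightarrow> bool" where
  "affine_automorphism2 F \<longleftrightarrow>
     bij F \<and> (\<exists>a b c d f g. F = (\<lambda>(x, y). (a * x + b * y + f, c * x + d * y + g)))"

definition elementary_henon :: "complex poly \<Rightarrow> complex \<Rightarrow> complex \<times> complex \<Rightarrow> complex \<times> complex" where
  "elementary_henon p \<delta> = (\<lambda>(x, y). (y, poly p y - \<delta> * x))"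

text \<open>
  A Henon map is given by the list \<open>[(p\<^sub>1, \<delta>\<^sub>1), \<dots>, (p\<^sub>k, \<delta>\<^sub>k)]\<close> of the data of its factors.
  The head of the list is the factor applied first.
\<close>

definition henon_data :: "(complex poly \<times> complex) list \<Rightarrow> bool" where
  "henon_data hs \<longleftrightarrow> hs \<noteq> [] \<and> (\<forall>(p, \<delta>) \<in> set hs. degree p \<ge> 2 \<and> \<delta> \<noteq> 0)"

definition henon_map :: "(complex poly \<times> complex) list \<Rightarrow> complex \<times> complex \<Rightarrow> complex \<times> complex" where
  "henon_map hs = fold (\<lambda>(p, \<delta>). elementary_henon p \<delta>) hs"

definition henon_degree :: "(complex poly \<times> complex) list \<Rightarrow> nat" where
  "henon_degree hs = (\<Prod>(p, \<delta>) \<leftarrow> hs. degree p)"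

text \<open>Since \<open>ln 0 = 0\<close> in the library, the convention \<open>log\<^sup>+ 0 = 0\<close> holds.\<close>

definition log_plus :: "real \<Rightarrow> real" where
  "log_plus t = max (ln t) 0"

definition green_plus :: "(complex poly \<times> complex) list \<Rightarrow> complex \<times> complex \<Rightarrow> real" where
  "green_plus hs z =
     lim (\<lambda>n. log_plus (norm ((henon_map hs ^^ n) z)) / real (henon_degree hs) ^ n)"

definition henon_sublevel :: "(complex poly \<times> complex) list \<Rightarrow> real \<Rightarrow> (complex \<times> complex) set" where
  "henon_sublevel hs c = {z. green_plus hs z < c}"

end

theory Submission
  imports Defs "HOL-Complex_Analysis.Complex_Analysis"
begin

text \<open>
  Write the orbit of \<open>(x, y)\<close> under the successive factors of \<open>H\<close> as a scalar sequence
  \<open>\<xi>\<^sub>0 = x\<close>, \<open>\<xi>\<^sub>1 = y\<close>, \<open>\<xi>\<^sub>n\<^sub>+\<^sub>2 = p\<^sub>n(\<xi>\<^sub>n\<^sub>+\<^sub>1) - \<delta>\<^sub>n \<xi>\<^sub>n\<close>; every \<open>\<xi>\<^sub>n\<close> is a polynomial in \<open>x, y\<close>,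
  and \<open>d\<^sub>1\<dots>d\<^sub>n G = log|\<xi>\<^sub>n\<^sub>+\<^sub>1| + const + O(1/|\<xi>\<^sub>n\<^sub>+\<^sub>1|)\<close> on escaping orbits.

  On a vertical line, \<open>G - c\<close> and \<open>G \<circ> F - c\<close> vanish on the boundary of the same unbounded domain and
  grow like multiples of \<open>log|y|\<close>. The maximum principle for quotients of powers of \<open>\<xi>\<^sub>n\<^sub>+\<^sub>1\<close> and
  \<open>\<xi>\<^sub>n\<^sub>+\<^sub>1 \<circ> F\<close> makes them proportional, so \<open>G \<circ> F - c = A (G - c)\<close> outside the sublevel set; \<open>A\<close> takes
  discrete values and depends continuously on the line, hence is constant.

  A polynomial injection \<open>B\<close> with \<open>G \<circ> B = G + \<kappa>\<close> for large \<open>G\<close> is very rigid: the error term above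
  forces \<open>\<xi>\<^sub>n \<circ> B = C\<^sub>n \<xi>\<^sub>n + w\<^sub>n\<close> with constants \<open>C\<^sub>n, w\<^sub>n\<close> for all large \<open>n\<close>. The recurrence then gives
  \<open>C\<^sub>n\<^sub>+\<^sub>2 = C\<^sub>n\<close> and \<open>C\<^sub>n\<^sub>+\<^sub>1\<^sup>d = C\<^sub>n\<close>, so \<open>|C\<^sub>n| = 1\<close> and \<open>\<kappa> = 0\<close>, and makes \<open>(C\<^sub>n, w\<^sub>n)\<close> periodic, so the
  affine map given by \<open>(C\<^sub>n, w\<^sub>n)\<close> commutes with \<open>H\<^sup>2\<close> and equals \<open>B\<close>. Applied to the
  commutator \<open>H F H\<^sup>-\<^sup>1 F\<^sup>-\<^sup>1\<close>, for which \<open>\<kappa> = (d - 1)(1 - A)c\<close>, this yields \<open>A = 1\<close>; applied to \<open>F\<close> itself it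
  then shows that \<open>F\<close> is affine.
\<close>

subsection \<open>Complex polynomials at infinity\<close>

lemma poly_eventually_dominates:
  fixes a b :: "complex poly"
  assumes "degree a < degree b"
  shows "\<forall>\<^sub>F t in at_infinity. R \<le> norm (poly b t) \<and> norm (poly a t) \<le> norm (poly b t)"
proof -
  have "((\<lambda>t. poly a t / poly b t) \<longlongrightarrow> 0) at_infinity"
    using assms by (rule poly_divide_tendsto_0_at_infinity)
  then have 1: "\<forall>\<^sub>F t in at_infinity. norm (poly a t / poly b t) < 1"
    by (metis order_tendstoD(2) tendsto_norm_zero zero_less_one)
  have "filterlim (poly b) at_infinity at_infinity"
    using assms by (intro filterlim_poly_at_infinity) auto
  then have 2: "\<forall>\<^sub>F t in at_infinity. max R 1 \<le> norm (poly b t)"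
    unfolding filterlim_at_infinity[OF order_refl] by (metis less_max_iff_disj zero_less_one)
  show ?thesis
    using 1 2 by eventually_elim (auto simp: norm_divide divide_simps split: if_splits)
qed

lemma eventually_poly_nonzero_at_infinity:
  fixes p :: "complex poly"
  assumes "p \<noteq> 0"
  shows "\<forall>\<^sub>F t in at_infinity. poly p t \<noteq> 0"
proof (cases "degree p = 0")
  case True
  then show ?thesis using assms by (auto elim: degree_eq_zeroE)
next
  case False
  then have "filterlim (poly p) at_infinity at_infinity"
    by (intro filterlim_poly_at_infinity) auto
  then have "\<forall>\<^sub>F t in at_infinity. 1 \<le> norm (poly p t)"
    by (simp add: filterlim_at_infinity[of 0])
  then show ?thesis by eventually_elim auto
qed

lemma ln_norm_poly_growth:
  fixes p :: "complex poly"
  assumes "p \<noteq> 0"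
  shows "\<exists>C r. \<forall>t. r \<le> norm t \<longrightarrow> \<bar>ln (norm (poly p t)) - degree p * ln (norm t)\<bar> \<le> C"
proof -
  let ?a = "ln (norm (lead_coeff p))"
  have "((\<lambda>t. poly p t / t ^ degree p) \<longlongrightarrow> lead_coeff p) at_infinity"
    by (rule poly_divide_tendsto_aux)
  then have lim: "((\<lambda>t. ln (norm (poly p t / t ^ degree p))) \<longlongrightarrow> ?a) at_infinity"
    by (intro tendsto_intros) (use assms in auto)
  have nz: "\<forall>\<^sub>F t in at_infinity. poly p t \<noteq> 0"
    using assms by (rule eventually_poly_nonzero_at_infinity) 
  have "\<forall>\<^sub>F t in at_infinity. dist (ln (norm (poly p t / t ^ degree p))) ?a < 1"
    using lim by (rule tendstoD) simp
  moreover have "\<forall>\<^sub>F t :: complex in at_infinity. t \<noteq> 0"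
    by (rule eventually_not_equal_at_infinity)
  ultimately have "\<forall>\<^sub>F t in at_infinity. \<bar>ln (norm (poly p t)) - degree p * ln (norm t)\<bar> \<le> \<bar>?a\<bar> + 1"
    using nz by eventually_elim
      (auto simp: dist_real_def norm_divide norm_power ln_div ln_realpow)
  then show ?thesis
    unfolding eventually_at_infinity by blast
qed

lemma abs_ln_norm_le:
  fixes w :: complex
  assumes "norm (w - 1) \<le> 1 / 2"
  shows "\<bar>ln (norm w)\<bar> \<le> 2 * norm (w - 1)"
proof -
  let ?e = "norm (w - 1)"
  have "norm w \<le> 1 + ?e" "1 - ?e \<le> norm w"
    using norm_triangle_ineq[of "w - 1" 1] norm_triangle_ineq2[of 1 "1 - w"]
    by (auto simp: norm_minus_commute)
  moreover have "norm w > 0"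
    using calculation(2) assms by linarith
  moreover have "ln (norm w) \<le> norm w - 1"
    using \<open>norm w > 0\<close> by (rule ln_le_minus_one)
  moreover have "- ln (norm w) \<le> 2 * ?e"
  proof -
    have "- ln (norm w) = ln (1 / norm w)"
      using \<open>norm w > 0\<close> by (simp add: ln_div)
    also have "\<dots> \<le> 1 / norm w - 1"
      using \<open>norm w > 0\<close> by (intro ln_le_minus_one) auto
    also have "\<dots> \<le> ?e / norm w"
      using \<open>norm w > 0\<close> \<open>1 - ?e \<le> norm w\<close> by (simp add: divide_simps)
    also have "\<dots> \<le> ?e / (1 / 2)"
      using \<open>norm w > 0\<close> \<open>1 - ?e \<le> norm w\<close> assms by (intro divide_left_mono) auto
    finally show ?thesis by simp
  qed
  ultimately show ?thesis
    by (smt (verit) norm_ge_zero)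
qed

lemma norm_poly_le_coeff_sum:
  fixes q :: "complex poly"
  assumes "degree q \<le> n" "1 \<le> norm y"
  shows "norm (poly q y) \<le> (\<Sum>i\<le>degree q. norm (coeff q i)) * norm y ^ n"
proof -
  have "norm (poly q y) \<le> (\<Sum>i\<le>degree q. norm (coeff q i * y ^ i))"
    unfolding poly_altdef by (rule norm_sum)
  also have "\<dots> \<le> (\<Sum>i\<le>degree q. norm (coeff q i) * norm y ^ n)"
  proof (rule sum_mono)
    fix i assume "i \<in> {..degree q}"
    then have "norm y ^ i \<le> norm y ^ n"
      using assms by (intro power_increasing) auto
    then show "norm (coeff q i * y ^ i) \<le> norm (coeff q i) * norm y ^ n"
      by (simp add: norm_mult norm_power mult_left_mono)
  qed
  finally show ?thesis
    by (simp add: sum_distrib_right)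
qed

lemma norm_poly_le_of_norm_le:
  fixes q :: "complex poly"
  assumes "norm y \<le> M"
  shows "norm (poly q y) \<le> (\<Sum>i\<le>degree q. norm (coeff q i) * M ^ i)"
proof -
  have "norm (poly q y) \<le> (\<Sum>i\<le>degree q. norm (coeff q i * y ^ i))"
    unfolding poly_altdef by (rule norm_sum)
  also have "\<dots> \<le> (\<Sum>i\<le>degree q. norm (coeff q i) * M ^ i)"
    using assms by (intro sum_mono) (auto simp: norm_mult norm_power intro!: mult_left_mono power_mono)
  finally show ?thesis .
qed

text \<open>The quotient w of \<open>poly p y - \<delta> * x\<close> by its dominant term
  \<open>a * y ^ d\<close> satisfies |w - 1| <= B / |y|, and taking logarithms gives the error term.
  Its decay in |y|, not just its boundedness, is what the rigidity argument rests on.\<close>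

lemma henon_step_growth:
  fixes p :: "complex poly" and \<delta> :: complex
  assumes deg: "degree p \<ge> 2"
  shows "\<exists>R\<ge>1. \<exists>K\<ge>0. \<forall>x y. R \<le> norm y \<longrightarrow> norm x \<le> norm y \<longrightarrow>
           2 * norm y \<le> norm (poly p y - \<delta> * x) \<and>
           \<bar>ln (norm (poly p y - \<delta> * x)) - degree p * ln (norm y) - ln (norm (lead_coeff p))\<bar> \<le> K / norm y"
proof -
  define a where "a = lead_coeff p"
  define d where "d = degree p"
  define q where "q = p - monom a d"
  have a: "a \<noteq> 0"
    using deg by (auto simp: a_def)
  have "degree q \<le> d - 1"
    unfolding q_def a_def d_def by (rule degree_le) (auto simp: coeff_eq_0)
  define B where "B = ((\<Sum>i\<le>degree q. norm (coeff q i)) + norm \<delta>) / norm a"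
  have B: "B \<ge> 0"
    unfolding B_def by (intro divide_nonneg_nonneg add_nonneg_nonneg sum_nonneg) auto
  \<comment> \<open>The entry \<open>2 * B\<close> gives |w - 1| <= 1/2, hence |w| >= 1/2; with
    \<open>4 / norm a\<close> this makes |w a y^d| at least 2 |y|.\<close>
  define R where "R = Max {1, 2 * B, 4 / norm a}"
  have R: "R \<ge> 1" "R \<ge> 2 * B" "R \<ge> 4 / norm a"
    by (auto simp: R_def)
  have main: "2 * norm y \<le> norm (poly p y - \<delta> * x) \<and>
     \<bar>ln (norm (poly p y - \<delta> * x)) - d * ln (norm y) - ln (norm a)\<bar> \<le> 2 * B / norm y"
    if y: "R \<le> norm y" and x: "norm x \<le> norm y" for x y
  proof -
    have y1: "1 \<le> norm y" "y \<noteq> 0"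
      using R y by auto
    define w where "w = (poly p y - \<delta> * x) / (a * y ^ d)"
    have d: "d = Suc (d - 1)" "d - 1 \<ge> 1"
      using deg by (auto simp: d_def)
    have py: "poly p y = a * y ^ d + poly q y"
      by (simp add: q_def poly_monom)
    have "w - 1 = (poly q y - \<delta> * x) / (a * y ^ d)"
      using a y1 by (simp add: w_def py field_simps)
    then have "norm (w - 1) = norm (poly q y - \<delta> * x) / (norm a * norm y ^ d)"
      by (simp add: norm_divide norm_mult norm_power)
    also have "norm (poly q y - \<delta> * x) \<le> norm (poly q y) + norm (\<delta> * x)"
      by (rule norm_triangle_ineq4)
    also have "norm (\<delta> * x) \<le> norm \<delta> * norm y ^ (d - 1)"
    proof -
      have "norm x \<le> norm y ^ 1" using x by simp
      also have "\<dots> \<le> norm y ^ (d - 1)"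
        using y1 d by (intro power_increasing) auto
      finally show ?thesis by (simp add: norm_mult mult_left_mono)
    qed
    also have "norm (poly q y) \<le> (\<Sum>i\<le>degree q. norm (coeff q i)) * norm y ^ (d - 1)"
      using \<open>degree q \<le> d - 1\<close> y1 by (intro norm_poly_le_coeff_sum)
    also have "((\<Sum>i\<le>degree q. norm (coeff q i)) * norm y ^ (d - 1) + norm \<delta> * norm y ^ (d - 1)) /
        (norm a * norm y ^ d) = B / norm y"
      using a y1 by (subst d(1)) (simp add: B_def field_simps)
    finally have w1: "norm (w - 1) \<le> B / norm y"
      by (simp add: divide_right_mono)
    have "B / norm y \<le> 1 / 2"
      using R y y1 by (auto simp: divide_simps)
    with w1 have w2: "norm (w - 1) \<le> 1 / 2" by linarith
    have w0: "norm w \<ge> 1 / 2"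
      using w2 norm_triangle_ineq2[of 1 "1 - w"] by (simp add: norm_minus_commute)
    have eq: "poly p y - \<delta> * x = w * (a * y ^ d)"
      using a y1 by (simp add: w_def)
    have "ln (norm (poly p y - \<delta> * x)) = ln (norm w) + ln (norm a) + d * ln (norm y)"
      unfolding eq using w0 a y1 by (auto simp: norm_mult ln_mult norm_power ln_realpow)
    then have "\<bar>ln (norm (poly p y - \<delta> * x)) - d * ln (norm y) - ln (norm a)\<bar> = \<bar>ln (norm w)\<bar>"
      by simp
    also have "\<dots> \<le> 2 * norm (w - 1)"
      using w2 by (rule abs_ln_norm_le)
    also have "\<dots> \<le> 2 * B / norm y"
      using w1 by simp
    finally have 1: "\<bar>ln (norm (poly p y - \<delta> * x)) - d * ln (norm y) - ln (norm a)\<bar> \<le> 2 * B / norm y" .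
    have "4 \<le> norm a * norm y"
    proof -
      have "4 / norm a \<le> norm y" using R(3) y by linarith
      then show ?thesis using a by (simp add: divide_simps mult.commute)
    qed
    then have "2 * norm y \<le> 1 / 2 * (norm a * norm y) * norm y"
      using y1 by (intro mult_right_mono) auto
    also have "\<dots> = 1 / 2 * (norm a * norm y ^ 2)"
      by (simp add: power2_eq_square)
    also have "\<dots> \<le> norm w * (norm a * norm y ^ d)"
      using w0 y1 deg by (intro mult_mono power_increasing mult_nonneg_nonneg) (auto simp: d_def)
    also have "\<dots> = norm (poly p y - \<delta> * x)"
      unfolding eq by (simp add: norm_mult norm_power)
    finally show ?thesis using 1 by blast
  qed
  show ?thesis
    using main R(1) B unfolding a_def d_def
    by (intro exI[of _ R] conjI exI[of _ "2 * B"]) auto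
qed

text \<open>Growth at infinity forces equal degrees and leading coefficients of modulus ratio
  \<rho>, so V = C Y + W with W of lower degree; a nonconstant W would make |V| - |C Y| unbounded
  along a suitable ray. The explicit bound on |w| later allows Liouville's theorem in a
  parameter.\<close>

lemma poly_norm_proportional_imp_affine:
  fixes V Y :: "complex poly"
  assumes degY: "degree Y \<ge> 1" and \<rho>: "\<rho> > 0"
    and bound: "\<And>y. r \<le> norm y \<Longrightarrow> \<bar>norm (poly V y) - \<rho> * norm (poly Y y)\<bar> \<le> K"
  shows "\<exists>C w. V = smult C Y + [:w:] \<and> norm C = \<rho> \<and> norm w \<le> K"
proof -
  define D where "D = degree Y"
  define a where "a = lead_coeff Y"
  have a: "a \<noteq> 0" using degY by (auto simp: a_def)
  have Ynz: "\<forall>\<^sub>F y in at_infinity. poly Y y \<noteq> 0"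
    using degY by (intro eventually_poly_nonzero_at_infinity) auto
  have ge_r: "\<forall>\<^sub>F y :: complex in at_infinity. r \<le> norm y"
    by (auto simp: eventually_at_infinity)
  have Yinf: "filterlim (poly Y) at_infinity at_infinity"
    using degY by (intro filterlim_poly_at_infinity) auto
  have ratio: "((\<lambda>y. norm (poly V y / poly Y y)) \<longlongrightarrow> \<rho>) at_infinity"
  proof (rule LIM_zero_cancel, rule Lim_null_comparison)
    show "\<forall>\<^sub>F y in at_infinity. norm (norm (poly V y / poly Y y) - \<rho>) \<le> norm (of_real K / poly Y y)"
      using Ynz ge_r
    proof eventually_elim
      case (elim y)
      have "norm (poly V y / poly Y y) - \<rho> = (norm (poly V y) - \<rho> * norm (poly Y y)) / norm (poly Y y)"
        using elim by (simp add: norm_divide field_simps)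
      also have "norm \<dots> \<le> \<bar>K\<bar> / norm (poly Y y)"
        using bound[OF elim(2)] by (simp add: divide_right_mono)
      finally show ?case by (simp add: norm_divide)
    qed
    show "((\<lambda>y. norm (of_real K / poly Y y)) \<longlongrightarrow> 0) at_infinity"
      by (intro tendsto_norm_zero tendsto_divide_0[OF tendsto_const] Yinf)
  qed
  have degV: "degree V = D"
  proof (rule ccontr)
    assume "degree V \<noteq> D"
    then consider "degree V < D" | "D < degree V" by linarith
    then show False
    proof cases
      case 1
      then have "((\<lambda>y. poly V y / poly Y y) \<longlongrightarrow> 0) at_infinity"
        unfolding D_def by (rule poly_divide_tendsto_0_at_infinity)
      then have "((\<lambda>y. norm (poly V y / poly Y y)) \<longlongrightarrow> 0) at_infinity"
        by (rule tendsto_norm_zero)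
      then show False
        using tendsto_unique[OF _ ratio] \<rho> by (simp add: trivial_limit_at_infinity)
    next
      case 2
      then have "((\<lambda>y. poly Y y / poly V y) \<longlongrightarrow> 0) at_infinity"
        unfolding D_def by (rule poly_divide_tendsto_0_at_infinity)
      then have 0: "((\<lambda>y. norm (poly Y y / poly V y)) \<longlongrightarrow> 0) at_infinity"
        by (rule tendsto_norm_zero)
      have "((\<lambda>y. inverse (norm (poly V y / poly Y y))) \<longlongrightarrow> inverse \<rho>) at_infinity"
        using \<rho> by (intro tendsto_inverse ratio) auto
      then have "((\<lambda>y. norm (poly Y y / poly V y)) \<longlongrightarrow> inverse \<rho>) at_infinity"
        by (simp add: norm_divide)
      then show False
        using tendsto_unique[OF _ 0, of "inverse \<rho>"] \<rho> by (simp add: trivial_limit_at_infinity)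
    qed
  qed
  define C where "C = lead_coeff V / a"
  define W where "W = V - smult C Y"
  have Ylim: "((\<lambda>y. poly Y y / y ^ D) \<longlongrightarrow> a) at_infinity"
    unfolding a_def D_def by (rule poly_divide_tendsto_aux)
  have nz: "\<forall>\<^sub>F y :: complex in at_infinity. y \<noteq> 0"
    by (rule eventually_not_equal_at_infinity)
  have "norm C = \<rho>"
  proof -
    have "((\<lambda>y. poly V y / y ^ D) \<longlongrightarrow> lead_coeff V) at_infinity"
      using degV poly_divide_tendsto_aux[of V] by simp
    then have "((\<lambda>y. norm ((poly V y / y ^ D) / (poly Y y / y ^ D))) \<longlongrightarrow> norm C) at_infinity"
      unfolding C_def using a by (intro tendsto_intros Ylim)
    moreover have "\<forall>\<^sub>F y in at_infinity. norm ((poly V y / y ^ D) / (poly Y y / y ^ D)) = norm (poly V y / poly Y y)"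
      using nz by eventually_elim auto
    ultimately have "((\<lambda>y. norm (poly V y / poly Y y)) \<longlongrightarrow> norm C) at_infinity"
      by (simp add: tendsto_cong)
    then show ?thesis
      using tendsto_unique[OF _ ratio] by (simp add: trivial_limit_at_infinity)
  qed
  with \<rho> have C: "C \<noteq> 0" by auto
  have degW: "degree W < D"
  proof -
    have "degree W \<le> D - 1"
    proof (rule degree_le, intro allI impI)
      fix i assume "D - 1 < i"
      then have "i = D \<or> D < i" by linarith
      then show "coeff W i = 0"
        using a degV by (auto simp: W_def C_def a_def D_def coeff_eq_0)
    qed
    then show ?thesis using degY by (simp add: D_def)
  qed
  have V: "V = smult C Y + W" by (simp add: W_def)
  show ?thesis
  proof (cases "W = 0")
    case True
    have "K \<ge> 0"
      using order_trans[OF abs_ge_zero bound[of "of_real \<bar>r\<bar>"]] by (simp add: abs_ge_self)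
    then show ?thesis
      using V True \<open>norm C = \<rho>\<close> by (intro exI[of _ C] exI[of _ 0]) auto
  next
    case False
    define m where "m = degree W"
    define b where "b = lead_coeff W"
    have b: "b \<noteq> 0" using False by (simp add: b_def)
    \<comment> \<open>Along the ray through \<open>\<omega>\<close> the remainder \<open>W\<close> points in the direction of \<open>C Y\<close>, so
      \<open>|V| - |C Y|\<close> is there at least of the order \<open>t ^ m\<close>.\<close>
    define \<omega> where "\<omega> = exp (Ln (b / (C * a)) / of_nat (D - m))"
    have \<omega>: "\<omega> ^ (D - m) = b / (C * a)"
      using degW a b C by (simp add: \<omega>_def m_def flip: exp_of_nat_mult)
    have \<omega>0: "\<omega> \<noteq> 0"
      by (simp add: \<omega>_def)
    define s where "s = (\<lambda>t :: real. \<omega> * of_real t)"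
    have s: "filterlim s at_infinity at_top"
      unfolding s_def using \<omega>0
      by (intro tendsto_mult_filterlim_at_infinity[OF tendsto_const] filterlim_of_real_at_infinity)
    have Wlim: "((\<lambda>y. poly W y / y ^ m) \<longlongrightarrow> b) at_infinity"
      unfolding b_def m_def by (rule poly_divide_tendsto_aux)
    \<comment> \<open>The product \<open>h t * t ^ m\<close> is |C Y| Re (W / (C Y)), a lower bound
      for |V| - |C Y|. It is written in normalised quotients so that its limit can be read
      off.\<close>
    define h where "h = (\<lambda>t. norm C * norm (poly Y (s t) / s t ^ D) * norm \<omega> ^ D *
       Re ((poly W (s t) / s t ^ m) / (C * (poly Y (s t) / s t ^ D)) / \<omega> ^ (D - m)))"
    define L where "L = norm C * norm a * norm \<omega> ^ D"
    have L: "L > 0" using a C \<omega>0 by (simp add: L_def)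
    have "(h \<longlongrightarrow> norm C * norm a * norm \<omega> ^ D * Re (b / (C * a) / \<omega> ^ (D - m))) at_top"
      unfolding h_def using a C \<omega>0
      by (intro tendsto_intros filterlim_compose[OF Wlim s] filterlim_compose[OF Ylim s]) auto
    then have hL: "(h \<longlongrightarrow> L) at_top"
      using a b C by (simp add: \<omega> L_def)
    have hK: "\<forall>\<^sub>F t in at_top. h t * t ^ m \<le> K"
    proof -
      have "\<forall>\<^sub>F t in at_top. r \<le> norm (s t)"
        using s ge_r by (rule eventually_compose_filterlim[rotated])
      moreover have "\<forall>\<^sub>F t in at_top. poly Y (s t) \<noteq> 0"
        using s Ynz by (rule eventually_compose_filterlim[rotated])
      moreover have "\<forall>\<^sub>F t :: real in at_top. t > 0"
        by (rule eventually_gt_at_top)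
      ultimately show ?thesis
      proof eventually_elim
        case (elim t)
        define Q where "Q = poly W (s t) / (C * poly Y (s t))"
        have st: "s t \<noteq> 0" using elim \<omega>0 by (simp add: s_def)
        have e1: "norm \<omega> ^ D * norm (poly Y (s t) / s t ^ D) = norm (poly Y (s t)) / t ^ D"
          using elim \<omega>0 by (simp add: s_def norm_divide norm_power norm_mult power_mult_distrib)
        have "(poly W (s t) / s t ^ m) / (C * (poly Y (s t) / s t ^ D)) / \<omega> ^ (D - m)
              = Q * (s t ^ D / s t ^ m / \<omega> ^ (D - m))"
          by (simp add: Q_def)
        also have "s t ^ D / s t ^ m = s t ^ (D - m)"
          using st degW by (simp add: m_def power_diff)
        also have "s t ^ (D - m) / \<omega> ^ (D - m) = of_real (t ^ (D - m))"
          using \<omega>0 by (simp add: s_def power_mult_distrib)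
        finally have e2: "Re ((poly W (s t) / s t ^ m) / (C * (poly Y (s t) / s t ^ D)) / \<omega> ^ (D - m))
              = Re Q * t ^ (D - m)"
          by simp
        have tD: "t ^ D = t ^ (D - m) * t ^ m"
          using degW by (simp add: m_def flip: power_add)
        have "h t * t ^ m = norm C * (norm (poly Y (s t)) / t ^ D) * (Re Q * t ^ (D - m)) * t ^ m"
          unfolding h_def e2 e1[symmetric] by simp
        also have "\<dots> = norm (C * poly Y (s t)) * Re Q"
          using elim unfolding tD by (simp add: norm_mult)
        also have "\<dots> \<le> norm (C * poly Y (s t)) * (norm (1 + Q) - 1)"
          using complex_Re_le_cmod[of "1 + Q"] by (intro mult_left_mono) auto
        also have "\<dots> = norm (C * poly Y (s t) * (1 + Q)) - norm (C * poly Y (s t))"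
          by (simp only: norm_mult right_diff_distrib mult_1_right)
        also have "C * poly Y (s t) * (1 + Q) = poly V (s t)"
          using elim C by (simp add: Q_def V field_simps)
        also have "norm (poly V (s t)) - norm (C * poly Y (s t)) \<le> K"
          using bound[OF elim(1)] \<open>norm C = \<rho>\<close> by (simp add: norm_mult)
        finally show ?case .
      qed
    qed
    have m: "m = 0"
    proof (rule ccontr)
      assume "m \<noteq> 0"
      then have "filterlim (\<lambda>t :: real. t ^ m) at_top at_top"
        by (intro filterlim_pow_at_top filterlim_ident) auto
      then have "filterlim (\<lambda>t. h t * t ^ m) at_top at_top"
        by (rule filterlim_tendsto_pos_mult_at_top[OF hL L])
      then have "\<forall>\<^sub>F t in at_top. K < h t * t ^ m"
        by (simp add: filterlim_at_top_dense)
      with hK have "\<forall>\<^sub>F t :: real in at_top. False"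
        by eventually_elim linarith
      then show False by simp
    qed
    \<comment> \<open>For m = 0 the choice of \<omega> gives |\<omega>|^D = |b| / |C a|, so the
      limit L is exactly the modulus of the constant W.\<close>
    have "L \<le> K"
      using hK m tendsto_le[OF _ tendsto_const hL, of K] by simp
    moreover have "L = norm b"
      using a C arg_cong[OF \<omega>, of norm] unfolding m L_def
      by (simp add: norm_power norm_divide norm_mult)
    moreover have "W = [:b:]"
      using m by (auto simp: b_def m_def elim: degree_eq_zeroE)
    ultimately show ?thesis
      using V \<open>norm C = \<rho>\<close> by blast
  qed
qed

lemma bounded_poly_constant:
  fixes p :: "complex poly"
  assumes "\<And>x. norm (poly p x) \<le> B"
  shows "poly p x = poly p 0"
proof -
  have "poly p constant_on UNIV"
    using assms by (intro Liouville_theorem holomorphic_intros) (auto simp: bounded_iff)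
  then show ?thesis by (auto simp: constant_on_def)
qed

subsection \<open>The Green function of a sequence of elementary maps\<close>

fun henon_orbit ::
  "(nat \<Rightarrow> complex poly) \<Rightarrow> (nat \<Rightarrow> complex) \<Rightarrow> complex \<times> complex \<Rightarrow> nat \<Rightarrow> complex" where
  "henon_orbit p \<delta> z 0 = fst z"
| "henon_orbit p \<delta> z (Suc 0) = snd z"
| "henon_orbit p \<delta> z (Suc (Suc n)) =
     poly (p n) (henon_orbit p \<delta> z (Suc n)) - \<delta> n * henon_orbit p \<delta> z n"

declare henon_orbit.simps(3) [simp del]

lemma log_plus_norm_pair:
  assumes "norm (x :: complex) \<le> norm (y :: complex)" "1 \<le> norm y"
  shows "\<bar>log_plus (norm (x, y)) - ln (norm y)\<bar> \<le> ln 2"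
proof -
  have "norm y \<le> norm (x, y)"
    by (rule norm_snd_le)
  moreover have "norm (x, y) \<le> 2 * norm y"
    using norm_Pair_le[of x y] assms by linarith
  moreover have "y \<noteq> 0" "(x, y) \<noteq> 0"
    using assms by (auto simp: zero_prod_def)
  ultimately have "ln (norm y) \<le> ln (norm (x, y))" "ln (norm (x, y)) \<le> ln 2 + ln (norm y)"
    using assms ln_mono[of "norm y" "norm (x, y)"] ln_mono[of "norm (x, y)" "2 * norm y"] by (auto simp: ln_mult)
  moreover have "log_plus (norm (x, y)) = ln (norm (x, y))"
    using \<open>norm y \<le> norm (x, y)\<close> assms by (simp add: log_plus_def)
  ultimately show ?thesis by simp
qed

lemma log_plus_nonneg: "0 \<le> log_plus t"
  by (simp add: log_plus_def)

lemma log_plus_le: "0 \<le> t \<Longrightarrow> t \<le> s \<Longrightarrow> 1 \<le> s \<Longrightarrow> log_plus t \<le> ln s"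
  by (cases "t = 0") (auto simp: log_plus_def)

text \<open>Since \<open>ln\<close> is discontinuous at 0, \<open>log_plus t\<close> is rewritten as
  \<open>ln (max t 1)\<close>, whose argument stays away from 0.\<close>

lemma continuous_on_log_plus:
  assumes "continuous_on S f" "\<And>x. x \<in> S \<Longrightarrow> 0 \<le> f x"
  shows "continuous_on S (\<lambda>x. log_plus (f x))"
proof -
  have "continuous_on S (\<lambda>x. ln (max (f x) 1))"
    by (intro continuous_intros assms(1)) auto
  moreover have "log_plus (f x) = ln (max (f x) 1)" if "x \<in> S" for x
    using assms(2)[OF that] by (cases "f x = 0") (auto simp: log_plus_def max_def)
  ultimately show ?thesis by (simp cong: continuous_on_cong)
qed

text \<open>One elementary map is applied per step, and the constants R and K serve all steps at
  once. The bound in \<open>step_bounded\<close> is also uniform in n; it controls the first value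
  after an orbit escapes.\<close>

locale henon_sequence =
  fixes p :: "nat \<Rightarrow> complex poly" and \<delta> :: "nat \<Rightarrow> complex" and R K :: real
  assumes degree_ge_2: "2 \<le> degree (p n)"
    and delta_nonzero: "\<delta> n \<noteq> 0"
    and R_ge_1: "1 \<le> R" and K_nonneg: "0 \<le> K"
    and step_norm: "R \<le> norm y \<Longrightarrow> norm x \<le> norm y \<Longrightarrow> 2 * norm y \<le> norm (poly (p n) y - \<delta> n * x)"
    and step_ln: "R \<le> norm y \<Longrightarrow> norm x \<le> norm y \<Longrightarrow>
      \<bar>ln (norm (poly (p n) y - \<delta> n * x)) - degree (p n) * ln (norm y) - ln (norm (lead_coeff (p n)))\<bar>
        \<le> K / norm y"
    and lead_coeff_bound: "\<bar>ln (norm (lead_coeff (p n)))\<bar> \<le> K"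
    and step_bounded: "\<exists>C. \<forall>n x y. norm x \<le> M \<longrightarrow> norm y \<le> M \<longrightarrow> norm (poly (p n) y - \<delta> n * x) \<le> C"
begin

abbreviation "\<xi> \<equiv> henon_orbit p \<delta>"

definition D :: "nat \<Rightarrow> nat" where "D n = (\<Prod>i<n. degree (p i))"

text \<open>This is membership of \<open>(\<xi>\<^sub>n, \<xi>\<^sub>n\<^sub>+\<^sub>1)\<close> in the forward invariant region usually called \<open>V\<^sup>+\<close>.\<close>

definition escaped :: "complex \<times> complex \<Rightarrow> nat \<Rightarrow> bool" where
  "escaped z n \<longleftrightarrow> R \<le> norm (\<xi> z (Suc n)) \<and> norm (\<xi> z n) \<le> norm (\<xi> z (Suc n))"

definition level :: "nat \<Rightarrow> complex \<times> complex \<Rightarrow> real" where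
  "level n z = log_plus (norm (\<xi> z n, \<xi> z (Suc n))) / D n"

definition green :: "complex \<times> complex \<Rightarrow> real" where
  "green z = lim (\<lambda>n. level n z)"

text \<open>This is the constant term in D_n G = log|xi_(n+1)| + const + O(1/|xi_(n+1)|): the
  accumulated contribution of the leading coefficients of all later steps.\<close>

definition offset :: "nat \<Rightarrow> real" where
  "offset n = D n * (\<Sum>i. ln (norm (lead_coeff (p (i + n)))) / D (Suc (i + n)))"

lemma D_0 [simp]: "D 0 = 1" and D_Suc: "D (Suc n) = degree (p n) * D n"
  by (auto simp: D_def)

lemma D_ge: "D n * 2 ^ i \<le> D (i + n)"
proof (induction i)
  case (Suc i)
  have "D n * 2 ^ Suc i = 2 * (D n * 2 ^ i)" by simp
  also have "\<dots> \<le> degree (p (i + n)) * D (i + n)"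
    using Suc degree_ge_2 by (intro mult_mono) auto
  finally show ?case by (simp add: D_Suc)
qed auto

lemma D_ge_power: "2 ^ n \<le> D n"
  using D_ge[of 0 n] by simp

lemma D_pos: "D n > 0"
  using D_ge_power[of n] by (metis less_le_trans zero_less_numeral zero_less_power)

lemma D_mono: "n \<le> m \<Longrightarrow> D n \<le> D m"
  using D_ge[of n "m - n"] by simp (metis le_trans mult.right_neutral mult_le_mono2 one_le_numeral one_le_power)

lemma D_at_top: "filterlim (\<lambda>n. real (D n)) at_top sequentially"
proof (rule filterlim_at_top_mono)
  show "filterlim (\<lambda>n. 2 ^ n :: real) at_top sequentially"
    by real_asymp
  show "\<forall>\<^sub>F n in sequentially. 2 ^ n \<le> real (D n)"
    using D_ge_power by (intro always_eventually allI) (metis of_nat_le_iff of_nat_numeral of_nat_power)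
qed

lemma divide_D_le:
  assumes "a \<ge> 0"
  shows "a / real (D (Suc (i + n))) \<le> a / D n * (1 / 2) ^ Suc i"
proof -
  have "real (D n * 2 ^ Suc i) \<le> real (D (Suc i + n))"
    using D_ge[of n "Suc i"] by (subst of_nat_le_iff)
  then have "a / D (Suc (i + n)) \<le> a / (D n * 2 ^ Suc i)"
    using assms D_pos[of n] D_pos[of "Suc (i+n)"] by (intro divide_left_mono) auto
  then show ?thesis by (simp add: field_simps)
qed

lemma summable_dyadic:
  fixes f :: "nat \<Rightarrow> real"
  assumes "\<And>i. \<bar>f i\<bar> \<le> a * (1 / 2) ^ Suc i"
  shows "summable f" "\<bar>suminf f\<bar> \<le> a"
proof -
  have g: "(\<lambda>i. a * (1 / 2) ^ Suc i) sums a"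
    using sums_mult[OF power_half_series, of a] by simp
  show "summable f"
    using assms by (intro summable_comparison_test'[OF sums_summable[OF g]]) auto
  show "\<bar>suminf f\<bar> \<le> a"
    using norm_suminf_le[of f, OF _ sums_summable[OF g]] assms sums_unique[OF g] by simp
qed

lemma offset_summable: "summable (\<lambda>i. ln (norm (lead_coeff (p (i + n)))) / D (Suc (i + n)))"
  and offset_le: "\<bar>offset n\<bar> \<le> K"
proof -
  have *: "\<bar>ln (norm (lead_coeff (p (i + n)))) / D (Suc (i + n))\<bar> \<le> K / D n * (1 / 2) ^ Suc i" for i
  proof -
    have "\<bar>ln (norm (lead_coeff (p (i + n)))) / D (Suc (i + n))\<bar> \<le> K / D (Suc (i + n))"
      using lead_coeff_bound[of "i + n"] by (simp add: divide_right_mono)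
    also have "\<dots> \<le> K / D n * (1 / 2) ^ Suc i"
      using K_nonneg by (rule divide_D_le)
    finally show ?thesis .
  qed
  show "summable (\<lambda>i. ln (norm (lead_coeff (p (i + n)))) / D (Suc (i + n)))"
    using * by (rule summable_dyadic)
  show "\<bar>offset n\<bar> \<le> K"
    using summable_dyadic(2)[OF *] D_pos[of n] by (simp add: offset_def abs_mult field_simps)
qed

lemma escaped_Suc:
  assumes "escaped z n"
  shows "2 * norm (\<xi> z (Suc n)) \<le> norm (\<xi> z (Suc (Suc n)))" "escaped z (Suc n)"
proof -
  show *: "2 * norm (\<xi> z (Suc n)) \<le> norm (\<xi> z (Suc (Suc n)))"
    using assms step_norm by (simp add: escaped_def henon_orbit.simps(3))
  then show "escaped z (Suc n)"
    using assms R_ge_1 unfolding escaped_def by linarith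
qed

lemma escaped_mono:
  assumes "escaped z n" "n \<le> m"
  shows "escaped z m" "norm (\<xi> z (Suc n)) \<le> norm (\<xi> z (Suc m))"
proof -
  have "escaped z m \<and> norm (\<xi> z (Suc n)) \<le> norm (\<xi> z (Suc m))"
    using assms(2,1)
  proof (induction rule: dec_induct)
    case (step m)
    then have "escaped z m" "norm (\<xi> z (Suc n)) \<le> norm (\<xi> z (Suc m))" by auto
    moreover from this have "escaped z (Suc m)" "2 * norm (\<xi> z (Suc m)) \<le> norm (\<xi> z (Suc (Suc m)))"
      using escaped_Suc by auto
    ultimately show ?case
      using norm_ge_zero[of "\<xi> z (Suc m)"] by linarith
  qed auto
  then show "escaped z m" "norm (\<xi> z (Suc n)) \<le> norm (\<xi> z (Suc m))" by auto
qed

lemma escaped_ge_1: "escaped z n \<Longrightarrow> 1 \<le> norm (\<xi> z (Suc n))"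
  using R_ge_1 by (simp add: escaped_def)

text \<open>Telescoping: l_m = log|xi_(m+1)| / D_m changes in one step by the leading coefficient
  term b_m up to an error at most K' / D_(m+1), summable because D at least doubles. Replacing the
  norm of the pair by that of its second entry costs at most log 2 / D_m.\<close>

lemma escaped_level_limit:
  assumes "escaped z n"
  shows "\<exists>L :: real. (\<lambda>m. level m z) \<longlonglongrightarrow> L \<and>
    \<bar>D n * L - ln (norm (\<xi> z (Suc n))) - offset n\<bar> \<le> K / norm (\<xi> z (Suc n))"
proof -
  define l where "l m = ln (norm (\<xi> z (Suc m))) / D m" for m
  define b where "b m = ln (norm (lead_coeff (p m))) / D (Suc m)" for m
  define e where "e m = l (Suc m) - l m - b m" for m
  define K' where "K' = K / norm (\<xi> z (Suc n))"
  have K': "K' \<ge> 0" using K_nonneg by (simp add: K'_def)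
  have e: "\<bar>e (i + n)\<bar> \<le> K' / D n * (1 / 2) ^ Suc i" for i
  proof -
    let ?m = "i + n"
    have esc: "escaped z ?m" and mono: "norm (\<xi> z (Suc n)) \<le> norm (\<xi> z (Suc ?m))"
      using escaped_mono[OF assms, of ?m] by auto
    have "e ?m = (ln (norm (\<xi> z (Suc (Suc ?m)))) - degree (p ?m) * ln (norm (\<xi> z (Suc ?m)))
        - ln (norm (lead_coeff (p ?m)))) / D (Suc ?m)"
      using D_pos[of ?m] degree_ge_2[of ?m]
      by (simp add: e_def l_def b_def D_Suc diff_divide_distrib)
    also have "\<bar>\<dots>\<bar> \<le> (K / norm (\<xi> z (Suc ?m))) / D (Suc ?m)"
    proof -
      have "\<bar>ln (norm (\<xi> z (Suc (Suc ?m)))) - degree (p ?m) * ln (norm (\<xi> z (Suc ?m)))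
        - ln (norm (lead_coeff (p ?m)))\<bar> \<le> K / norm (\<xi> z (Suc ?m))"
        unfolding henon_orbit.simps(3) using esc by (intro step_ln) (auto simp: escaped_def)
      then show ?thesis
        unfolding abs_divide by (simp only: abs_of_nat) (intro divide_right_mono, auto)
    qed
    also have "\<dots> \<le> K' / D (Suc ?m)"
    proof (rule divide_right_mono)
      show "K / norm (\<xi> z (Suc ?m)) \<le> K'"
        unfolding K'_def using mono escaped_ge_1[OF assms] K_nonneg
        by (intro divide_left_mono mult_pos_pos) linarith+
    qed simp
    also have "\<dots> \<le> K' / D n * (1 / 2) ^ Suc i"
      using K' by (rule divide_D_le)
    finally show ?thesis .
  qed
  have sb: "summable (\<lambda>i. b (i + n))"
    using offset_summable by (simp add: b_def)
  have se: "summable (\<lambda>i. e (i + n))" and e_le: "\<bar>\<Sum>i. e (i + n)\<bar> \<le> K' / D n"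
    using summable_dyadic[OF e] by auto
  define L where "L = l n + ((\<Sum>i. b (i + n)) + (\<Sum>i. e (i + n)))"
  have "l (N + n) = l n + ((\<Sum>i<N. b (i + n)) + (\<Sum>i<N. e (i + n)))" for N
    by (induction N) (auto simp: e_def)
  moreover have "(\<lambda>N. l n + ((\<Sum>i<N. b (i + n)) + (\<Sum>i<N. e (i + n)))) \<longlonglongrightarrow> L"
    unfolding L_def by (intro tendsto_intros summable_LIMSEQ sb se)
  ultimately have "(\<lambda>N. l (N + n)) \<longlonglongrightarrow> L" by simp
  then have lL: "l \<longlonglongrightarrow> L" by (rule LIMSEQ_offset)
  have "(\<lambda>m. level m z - l m) \<longlonglongrightarrow> 0"
  proof (rule Lim_null_comparison)
    show "\<forall>\<^sub>F m in sequentially. norm (level m z - l m) \<le> ln 2 / D m"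
      using eventually_ge_at_top[of n]
    proof eventually_elim
      case (elim m)
      then have m: "escaped z m" using escaped_mono[OF assms] by auto
      have "level m z - l m = (log_plus (norm (\<xi> z m, \<xi> z (Suc m))) - ln (norm (\<xi> z (Suc m)))) / D m"
        by (simp add: level_def l_def diff_divide_distrib)
      also have "norm \<dots> \<le> ln 2 / D m"
        using log_plus_norm_pair[of "\<xi> z m" "\<xi> z (Suc m)"] m escaped_ge_1[OF m]
        by (simp add: escaped_def divide_right_mono)
      finally show ?case .
    qed
    show "(\<lambda>m. ln 2 / real (D m)) \<longlonglongrightarrow> 0"
      by (intro real_tendsto_divide_at_top[OF tendsto_const] D_at_top)
  qed
  from tendsto_add[OF this lL] have "(\<lambda>m. level m z) \<longlonglongrightarrow> L" by simp
  moreover have "D n * L - ln (norm (\<xi> z (Suc n))) - offset n = D n * (\<Sum>i. e (i + n))"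
    using D_pos[of n] by (simp add: L_def l_def offset_def b_def field_simps)
  moreover have "\<bar>D n * (\<Sum>i. e (i + n))\<bar> \<le> K'"
    using e_le D_pos[of n] by (simp add: abs_mult field_simps)
  ultimately show ?thesis by (auto simp: K'_def)
qed

text \<open>Forward invariance makes every earlier index non-escaped too, and then each new entry is
  below R or below its predecessor. Non-escape at n thus still controls the entry of index n +
  1.\<close>

lemma not_escaped_norm_le:
  assumes "\<not> escaped z n" "norm z \<le> M" "i \<le> Suc n"
  shows "norm (\<xi> z i) \<le> max R M"
  using assms(3)
proof (induction i)
  case 0
  then show ?case
    using norm_fst_le[of "fst z" "snd z"] assms(2) by simp
next
  case (Suc i)
  then have "\<not> escaped z i"
    using escaped_mono(1)[of z i n] assms(1) by auto
  then show ?case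
    using Suc by (auto simp: escaped_def)
qed

lemma not_escaped_level_le:
  assumes "\<not> escaped z n" "norm z \<le> M"
  shows "level n z \<le> ln (2 * max R M) / D n"
proof -
  have "norm (\<xi> z n, \<xi> z (Suc n)) \<le> 2 * max R M"
    using norm_Pair_le[of "\<xi> z n" "\<xi> z (Suc n)"] not_escaped_norm_le[OF assms, of n]
      not_escaped_norm_le[OF assms, of "Suc n"] by auto
  then show ?thesis
    unfolding level_def using R_ge_1 by (intro divide_right_mono log_plus_le) auto
qed

lemma level_nonneg: "0 \<le> level n z"
  by (simp add: level_def log_plus_nonneg)

lemma never_escaped_limit:
  assumes "\<And>n. \<not> escaped z n"
  shows "(\<lambda>n. level n z) \<longlonglongrightarrow> 0"
proof (rule Lim_null_comparison)
  show "\<forall>\<^sub>F n in sequentially. norm (level n z) \<le> ln (2 * max R (norm z)) / D n"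
    using not_escaped_level_le[OF assms order_refl] level_nonneg by simp
  show "(\<lambda>n. ln (2 * max R (norm z)) / real (D n)) \<longlonglongrightarrow> 0"
    by (intro real_tendsto_divide_at_top[OF tendsto_const] D_at_top)
qed

lemma level_tendsto_green: "(\<lambda>n. level n z) \<longlonglongrightarrow> green z"
  unfolding green_def
  using never_escaped_limit escaped_level_limit by (metis limI)

lemma green_nonneg: "0 \<le> green z"
  using level_tendsto_green by (rule LIMSEQ_le_const) (auto simp: level_nonneg)

lemma escaped_green:
  assumes "escaped z n"
  shows "\<bar>D n * green z - ln (norm (\<xi> z (Suc n))) - offset n\<bar> \<le> K / norm (\<xi> z (Suc n))"
  using escaped_level_limit[OF assms] level_tendsto_green LIMSEQ_unique by blast

lemma escaped_green_bounded:
  assumes "escaped z n"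
  shows "\<bar>D n * green z - ln (norm (\<xi> z (Suc n)))\<bar> \<le> 2 * K"
proof -
  have "K / norm (\<xi> z (Suc n)) \<le> K / 1"
    using escaped_ge_1[OF assms] K_nonneg by (intro divide_left_mono) auto
  then show ?thesis
    using escaped_green[OF assms] offset_le[of n] by linarith
qed

text \<open>If m > n is the first escape time, the entry of index m + 1 comes from two entries
  bounded by \<open>max R M\<close>, so D_m G is bounded by a constant depending only on M. An orbit
  that never escapes has G = 0.\<close>

lemma not_escaped_green_le: "\<exists>C :: real. \<forall>z n. norm z \<le> M \<longrightarrow> \<not> escaped z n \<longrightarrow> green z \<le> C / D n"
proof -
  obtain C where C: "norm (poly (p n) y - \<delta> n * x) \<le> C"
    if "norm x \<le> max R M" "norm y \<le> max R M" for n x y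
    using step_bounded[of "max R M"] by blast
  define C' where "C' = ln (max C 1) + 2 * K"
  have C'0: "C' \<ge> 0" using K_nonneg by (simp add: C'_def)
  have "green z \<le> C' / D n" if z: "norm z \<le> M" "\<not> escaped z n" for z n
  proof (cases "\<exists>m. escaped z m")
    case True
    define m where "m = (LEAST m. escaped z m)"
    have m: "escaped z m"
      using True unfolding m_def by (meson LeastI_ex)
    then have "n < m"
      using z escaped_mono(1)[of z m n] by force
    then obtain m' where m': "m = Suc m'" "n \<le> m'"
      by (metis less_imp_Suc_add le_add1)
    then have "\<not> escaped z m'"
      using not_less_Least[of m' "escaped z"] by (simp add: m_def)
    then have "norm (\<xi> z (Suc m)) \<le> C"
      using C[of "\<xi> z m'" "\<xi> z (Suc m')" m'] not_escaped_norm_le[of z m' M] z by (simp add: m' henon_orbit.simps(3))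
    then have "ln (norm (\<xi> z (Suc m))) \<le> ln (max C 1)"
      using escaped_ge_1[OF m] by (intro ln_mono) auto
    then have "D m * green z \<le> C'"
      using escaped_green_bounded[OF m] unfolding C'_def by linarith
    then have "green z \<le> C' / D m"
      using D_pos[of m] by (simp add: field_simps)
    also have "\<dots> \<le> C' / D n"
      using C'0 D_pos D_mono[of n m] \<open>n < m\<close> by (intro divide_left_mono) auto
    finally show ?thesis .
  next
    case False
    then have "green z = 0"
      using never_escaped_limit level_tendsto_green LIMSEQ_unique by blast
    then show ?thesis
      using C'0 by simp
  qed
  then show ?thesis by blast
qed

text \<open>Escaped points satisfy the logarithmic estimate; for the others both terms are O(1/D_n).
  The uniformity on balls yields continuity of G.\<close>

lemma green_level_uniform: "\<exists>C :: real. \<forall>z n. norm z \<le> M \<longrightarrow> \<bar>green z - level n z\<bar> \<le> C / D n"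
proof -
  obtain C where C: "green z \<le> C / D n" if "norm z \<le> M" "\<not> escaped z n" for z n
    using not_escaped_green_le by blast
  define C' where "C' = Max {C, ln (2 * max R M), 2 * K + ln 2}"
  have C': "C \<le> C'" "ln (2 * max R M) \<le> C'" "2 * K + ln 2 \<le> C'"
    by (auto simp: C'_def)
  have "\<bar>green z - level n z\<bar> \<le> C' / D n" if z: "norm z \<le> M" for z n
  proof (cases "escaped z n")
    case True
    have "\<bar>D n * green z - log_plus (norm (\<xi> z n, \<xi> z (Suc n)))\<bar> \<le> 2 * K + ln 2"
    proof -
      have "\<bar>log_plus (norm (\<xi> z n, \<xi> z (Suc n))) - ln (norm (\<xi> z (Suc n)))\<bar> \<le> ln 2"
        using True escaped_ge_1[OF True] by (intro log_plus_norm_pair) (auto simp: escaped_def)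
      then show ?thesis
        using escaped_green_bounded[OF True] by linarith
    qed
    then have "\<bar>D n * green z - D n * level n z\<bar> \<le> C'"
      using C' D_pos[of n] by (simp add: level_def)
    then have "D n * \<bar>green z - level n z\<bar> \<le> C'"
      by (metis abs_mult abs_of_nat right_diff_distrib)
    then show ?thesis
      using D_pos[of n] by (simp add: field_simps)
  next
    case False
    have "C / D n \<le> C' / D n" "ln (2 * max R M) / D n \<le> C' / D n"
      using C' by (auto intro!: divide_right_mono)
    then show ?thesis
      using C[OF z False] not_escaped_level_le[OF False z] green_nonneg[of z] level_nonneg[of n z]
      by linarith
  qed
  then show ?thesis by blast
qed

lemma continuous_on_orbit [continuous_intros]:
  assumes "continuous_on S f"
  shows "continuous_on S (\<lambda>x. \<xi> (f x) n)"
  by (induction n rule: induct_nat_012) (auto simp: henon_orbit.simps(3) intro!: continuous_intros assms)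

lemma continuous_on_green: "continuous_on UNIV green"
proof -
  have "continuous_on (ball 0 M) green" for M
  proof -
    obtain C where C: "\<bar>green z - level n z\<bar> \<le> C / D n" if "norm z \<le> M" for z n
      using green_level_uniform by blast
    have "uniform_limit (ball 0 M) level green sequentially"
    proof (rule uniform_limitI)
      fix e :: real assume "e > 0"
      have "(\<lambda>n. C / real (D n)) \<longlonglongrightarrow> 0"
        by (intro real_tendsto_divide_at_top[OF tendsto_const] D_at_top)
      then have "\<forall>\<^sub>F n in sequentially. C / real (D n) < e"
        using \<open>e > 0\<close> by (rule order_tendstoD)
      then show "\<forall>\<^sub>F n in sequentially. \<forall>z\<in>ball 0 M. dist (level n z) (green z) < e"
      proof eventually_elim
        case (elim n)
        show ?case
        proof
          fix z :: "complex \<times> complex" assume "z \<in> ball 0 M"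
          then show "dist (level n z) (green z) < e"
            using C[of z n] elim by (simp add: dist_real_def abs_minus_commute)
        qed
      qed
    qed
    moreover have "continuous_on (ball 0 M) (level n)" for n
    proof -
      have "continuous_on (ball 0 M) (\<lambda>z. \<xi> z i)" for i
        by (rule continuous_on_orbit[OF continuous_on_id])
      then have "continuous_on (ball 0 M) (\<lambda>z. norm (\<xi> z n, \<xi> z (Suc n)))"
        by (intro continuous_on_norm continuous_on_Pair)
      then have "continuous_on (ball 0 M) (\<lambda>z. log_plus (norm (\<xi> z n, \<xi> z (Suc n))))"
        by (rule continuous_on_log_plus) (rule norm_ge_zero)
      moreover have "level n = (\<lambda>z. log_plus (norm (\<xi> z n, \<xi> z (Suc n))) * inverse (D n))"
        by (rule ext) (simp add: level_def divide_inverse)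
      ultimately show ?thesis
        by (simp add: continuous_on_mult_right)
    qed
    ultimately show ?thesis
      by (intro uniform_limit_theorem[where f = level and F = sequentially]) auto
  qed
  then have "isCont green z" for z
    using continuous_on_eq_continuous_at[OF open_ball, of 0 "norm z + 1" green] by simp
  then show ?thesis
    by (simp add: continuous_on_eq_continuous_at)
qed

text \<open>A point of the ball that has not escaped at time n has G at most C / D_n, which is below
  c for large n. One time therefore serves the whole bounded part of {G >= c}.\<close>

lemma eventually_escaped:
  assumes "c > 0"
  shows "\<forall>\<^sub>F n in sequentially. \<forall>z. norm z \<le> M \<longrightarrow> c \<le> green z \<longrightarrow> escaped z n"
proof -
  obtain C where C: "green z \<le> C / D n" if "norm z \<le> M" "\<not> escaped z n" for z n
    using not_escaped_green_le by blast
  have "(\<lambda>n. C / real (D n)) \<longlonglongrightarrow> 0"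
    by (intro real_tendsto_divide_at_top[OF tendsto_const] D_at_top)
  then have "\<forall>\<^sub>F n in sequentially. C / real (D n) < c"
    using \<open>c > 0\<close> by (rule order_tendstoD)
  then show ?thesis
    by eventually_elim (use C in force)
qed

end

subsection \<open>Polynomial maps of the plane and their orbits\<close>

text \<open>The restriction to the vertical line over x, as a polynomial in y. The expression
  \<open>poly P [:y:]\<close> fixes the other variable.\<close>

definition poly_slice :: "complex \<Rightarrow> complex poly poly \<Rightarrow> complex poly" where
  "poly_slice x P = map_poly (\<lambda>c. poly c x) P"

lemma poly_poly_slice: "poly (poly P [:y:]) x = poly (poly_slice x P) y"
  unfolding poly_slice_def by (induction P) (auto simp: map_poly_pCons)

lemma coeff_poly_slice: "coeff (poly_slice x P) i = poly (coeff P i) x"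
  by (simp add: poly_slice_def coeff_map_poly)

lemma degree_poly_slice_le: "degree (poly_slice x P) \<le> degree P"
  by (rule degree_le) (simp add: coeff_poly_slice coeff_eq_0)

lemma polynomial_function2_iff_slice:
  "polynomial_function2 f \<longleftrightarrow> (\<exists>P. \<forall>x y. f (x, y) = poly (poly_slice x P) y)"
  by (simp add: polynomial_function2_def poly_poly_slice)

lemma polynomial_function2_const: "polynomial_function2 (\<lambda>z. c)"
  unfolding polynomial_function2_def by (rule exI[of _ "[:[:c:]:]"]) simp

lemma polynomial_function2_fst: "polynomial_function2 fst"
  unfolding polynomial_function2_def by (rule exI[of _ "[:[:0, 1:]:]"]) simp

lemma polynomial_function2_snd: "polynomial_function2 snd"
  unfolding polynomial_function2_def by (rule exI[of _ "[:0, 1:]"]) simp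

lemma polynomial_function2_add:
  "polynomial_function2 f \<Longrightarrow> polynomial_function2 g \<Longrightarrow> polynomial_function2 (\<lambda>z. f z + g z)"
  unfolding polynomial_function2_def by (metis poly_add)

lemma polynomial_function2_mult:
  "polynomial_function2 f \<Longrightarrow> polynomial_function2 g \<Longrightarrow> polynomial_function2 (\<lambda>z. f z * g z)"
  unfolding polynomial_function2_def by (metis poly_mult)

lemma polynomial_function2_diff:
  "polynomial_function2 f \<Longrightarrow> polynomial_function2 g \<Longrightarrow> polynomial_function2 (\<lambda>z. f z - g z)"
  unfolding polynomial_function2_def by (metis poly_diff)

lemma polynomial_function2_poly:
  assumes "polynomial_function2 f"
  shows "polynomial_function2 (\<lambda>z. poly q (f z))"
  by (induction q)
    (auto intro!: polynomial_function2_const polynomial_function2_add polynomial_function2_mult assms)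

lemma polynomial_function2_compose:
  assumes f: "polynomial_function2 f" and F: "polynomial_map2 F"
  shows "polynomial_function2 (\<lambda>z. f (F z))"
proof -
  have F': "polynomial_function2 (\<lambda>z. fst (F z))" "polynomial_function2 (\<lambda>z. snd (F z))"
    using F by (auto simp: polynomial_map2_def comp_def)
  obtain P where P: "f (x, y) = poly (poly P [:y:]) x" for x y
    using f by (auto simp: polynomial_function2_def)
  have "polynomial_function2 (\<lambda>z. poly (poly P [:snd (F z):]) (fst (F z)))"
    by (induction P) (auto intro!: polynomial_function2_const polynomial_function2_add
        polynomial_function2_mult polynomial_function2_poly F')
  moreover have "poly (poly P [:snd (F z):]) (fst (F z)) = f (F z)" for z
    using P[of "fst (F z)" "snd (F z)"] by simp
  ultimately show ?thesis by simp
qed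

lemma polynomial_map2_compose:
  assumes "polynomial_map2 F" "polynomial_map2 G"
  shows "polynomial_map2 (\<lambda>z. F (G z))"
  using assms(1) polynomial_function2_compose[OF _ assms(2)]
  unfolding polynomial_map2_def by (auto simp: comp_def)

lemma continuous_on_polynomial_function2:
  assumes "polynomial_function2 f"
  shows "continuous_on S f"
proof -
  obtain P where P: "f (x, y) = poly (poly P [:y:]) x" for x y
    using assms by (auto simp: polynomial_function2_def)
  have "continuous_on S (\<lambda>z. poly (poly P [:snd z:]) (fst z))"
    by (induction P) (auto intro!: continuous_intros)
  moreover have "(\<lambda>z. poly (poly P [:snd z:]) (fst z)) = f"
    using P by (auto simp flip: P)
  ultimately show ?thesis by metis
qed

lemma continuous_on_polynomial_map2:
  assumes "polynomial_map2 F"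
  shows "continuous_on S F"
proof -
  have "continuous_on S (\<lambda>z. (fst (F z), snd (F z)))"
    using assms by (intro continuous_on_Pair continuous_on_polynomial_function2)
      (auto simp: polynomial_map2_def comp_def)
  then show ?thesis by simp
qed

lemma polynomial_function2_orbit: "polynomial_function2 (\<lambda>z. henon_orbit p \<delta> z n)"
proof (induction n rule: induct_nat_012)
  case (ge2 n)
  then show ?case
    by (auto simp: henon_orbit.simps(3) intro!: polynomial_function2_diff polynomial_function2_mult
        polynomial_function2_poly polynomial_function2_const)
qed (use polynomial_function2_fst polynomial_function2_snd in auto)

section \<open>Orbits along polynomial curves\<close>

fun orbit_poly :: "(nat \<Rightarrow> complex poly) \<Rightarrow> (nat \<Rightarrow> complex) \<Rightarrow> complex poly \<Rightarrow> complex poly \<Rightarrow>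
    nat \<Rightarrow> complex poly" where
  "orbit_poly p \<delta> u v 0 = u"
| "orbit_poly p \<delta> u v (Suc 0) = v"
| "orbit_poly p \<delta> u v (Suc (Suc n)) =
     pcompose (p n) (orbit_poly p \<delta> u v (Suc n)) - smult (\<delta> n) (orbit_poly p \<delta> u v n)"

declare orbit_poly.simps(3) [simp del]

lemma poly_orbit_poly:
  "poly (orbit_poly p \<delta> u v n) t = henon_orbit p \<delta> (poly u t, poly v t) n"
  by (induction n rule: induct_nat_012)
    (auto simp: poly_pcompose orbit_poly.simps(3) henon_orbit.simps(3))

lemma degree_pcompose_diff_smult:
  fixes q a b :: "complex poly"
  assumes "degree b < degree q * degree a"
  shows "degree (pcompose q a - smult c b) = degree q * degree a"
    "lead_coeff (pcompose q a - smult c b) = lead_coeff q * lead_coeff a ^ degree q"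
proof -
  have lt: "degree (- smult c b) < degree (pcompose q a)"
    using assms degree_smult_le[of c b] by (simp add: degree_pcompose)
  have "degree (pcompose q a + (- smult c b)) = degree (pcompose q a)"
    using lt by (rule degree_add_eq_left)
  then show deg: "degree (pcompose q a - smult c b) = degree q * degree a"
    by (simp add: degree_pcompose)
  have "lead_coeff (pcompose q a - smult c b) = lead_coeff (pcompose q a)"
    using deg assms by (simp add: degree_pcompose coeff_eq_0)
  also have "\<dots> = lead_coeff q * lead_coeff a ^ degree q"
    using assms by (intro lead_coeff_comp) (auto intro: gr0I)
  finally show "lead_coeff (pcompose q a - smult c b) = lead_coeff q * lead_coeff a ^ degree q" .
qed

context henon_sequence
begin

primrec vertical_lead :: "nat \<Rightarrow> complex" where
  "vertical_lead 0 = 1"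
| "vertical_lead (Suc n) = lead_coeff (p n) * vertical_lead n ^ degree (p n)"

text \<open>The degree is multiplied by deg p_n in each step, so the subtracted term never reaches
  the top coefficient. Independence of x is the point: it turns comparisons of leading coefficients
  on single lines into polynomial identities in x.\<close>

lemma vertical_orbit_poly:
  "degree (orbit_poly p \<delta> [:x:] [:0, 1:] (Suc n)) = D n"
  "lead_coeff (orbit_poly p \<delta> [:x:] [:0, 1:] (Suc n)) = vertical_lead n"
proof -
  let ?o = "orbit_poly p \<delta> [:x:] [:0, 1:]"
  have "degree (?o (Suc n)) = D n \<and> lead_coeff (?o (Suc n)) = vertical_lead n \<and>
    degree (?o n) < degree (?o (Suc n))"
  proof (induction n)
    case (Suc n)
    have o: "?o (Suc (Suc n)) = pcompose (p n) (?o (Suc n)) - smult (\<delta> n) (?o n)"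
      by (rule orbit_poly.simps(3))
    have lt: "D n < degree (p n) * D n"
      using degree_ge_2[of n] D_pos[of n] by simp
    moreover have "degree (?o (Suc n)) = D n" "degree (?o n) < D n"
      using Suc by auto
    ultimately have "degree (?o n) < degree (p n) * degree (?o (Suc n))"
      by (simp only:)
    note lead = degree_pcompose_diff_smult[OF this, of "\<delta> n", folded o]
    have "degree (?o (Suc (Suc n))) = D (Suc n)"
      using lead(1) Suc by (simp only: D_Suc)
    moreover have "lead_coeff (?o (Suc (Suc n))) = vertical_lead (Suc n)"
    proof -
      have "lead_coeff (?o (Suc n)) = vertical_lead n" using Suc by blast
      then show ?thesis unfolding lead(2) vertical_lead.simps by (rule arg_cong)
    qed
    ultimately show ?case
      using Suc lt by (simp add: D_Suc)
  qed auto
  then show "degree (?o (Suc n)) = D n" "lead_coeff (?o (Suc n)) = vertical_lead n" by auto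
qed

lemma escaped_vertical:
  assumes "R \<le> norm y" "norm x \<le> norm y"
  shows "escaped (x, y) 0"
  using assms by (simp add: escaped_def)

text \<open>Once the degree fails to drop in one step, it grows strictly ever after. It can drop at
  most deg u times in a row from the start, hence the threshold on n.\<close>

lemma orbit_poly_degree_increasing:
  assumes nonconst: "\<not> (degree u = 0 \<and> degree v = 0)" and deg: "degree u < n"
  shows "degree (orbit_poly p \<delta> u v n) < degree (orbit_poly p \<delta> u v (Suc n))"
proof -
  let ?o = "orbit_poly p \<delta> u v"
  \<comment> \<open>The recurrence can be solved for its oldest term because \<delta> is nonzero, so
    two consecutive constants would force constants at all earlier indices.\<close>
  have nc: "\<not> (degree (?o n) = 0 \<and> degree (?o (Suc n)) = 0)" for n
  proof (induction n)
    case 0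
    then show ?case using nonconst by simp
  next
    case (Suc n)
    show ?case
    proof
      assume 0: "degree (?o (Suc n)) = 0 \<and> degree (?o (Suc (Suc n))) = 0"
      have "smult (\<delta> n) (?o n) = pcompose (p n) (?o (Suc n)) - ?o (Suc (Suc n))"
        by (simp add: orbit_poly.simps(3))
      then have "degree (smult (\<delta> n) (?o n)) \<le> 0"
        using 0 degree_diff_le[of "pcompose (p n) (?o (Suc n))" 0 "?o (Suc (Suc n))"]
        by (simp add: degree_pcompose)
      then show False
        using Suc 0 delta_nonzero by simp
    qed
  qed
  have step: "degree (?o (Suc n)) < degree (?o (Suc (Suc n)))" if "degree (?o n) \<le> degree (?o (Suc n))" for n
  proof -
    have pos: "degree (?o (Suc n)) > 0" using nc[of n] that by linarith
    have "2 * degree (?o (Suc n)) \<le> degree (p n) * degree (?o (Suc n))"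
      using degree_ge_2 by (intro mult_right_mono) auto
    then show ?thesis
      unfolding orbit_poly.simps(3) using that pos
      by (subst degree_pcompose_diff_smult) linarith+
  qed
  have "\<exists>m<n. degree (?o m) \<le> degree (?o (Suc m))"
  proof (rule ccontr)
    assume "\<not> ?thesis"
    then have less: "degree (?o (Suc m)) < degree (?o m)" if "m < n" for m
      using that by (metis not_le)
    have "m \<le> n \<Longrightarrow> degree (?o m) + m \<le> degree u" for m
    proof (induction m)
      case (Suc m)
      then show ?case using less[of m] by linarith
    qed simp
    from this[of n] deg show False by simp
  qed
  then obtain m where "m < n" and m: "degree (?o m) \<le> degree (?o (Suc m))" by blast
  have "Suc m \<le> n" using \<open>m < n\<close> by simp
  then show ?thesis
    by (induction rule: dec_induct) (use step m less_imp_le in auto)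
qed

lemma curve_eventually_escaped:
  assumes "\<not> (degree u = 0 \<and> degree v = 0)" "degree u < n"
  shows "\<forall>\<^sub>F t in at_infinity. escaped (poly u t, poly v t) n"
  using poly_eventually_dominates[OF orbit_poly_degree_increasing[OF assms], of R]
  by (simp add: escaped_def poly_orbit_poly)

end

text \<open>
  The natural exponents \<open>j\<close> and \<open>k\<close> make \<open>a\<^sub>n ^ j / b\<^sub>n ^ k\<close> single-valued, so that the maximum modulus
  principle replaces a theory of harmonic functions.
\<close>

lemma subharmonic_comparison:
  fixes \<alpha> \<beta> :: "complex \<Rightarrow> real" and a b :: "nat \<Rightarrow> complex poly" and N :: "nat \<Rightarrow> real" and j k :: nat
  assumes W: "open W" and N: "filterlim N at_top sequentially"
    and approx: "\<And>M. \<forall>\<^sub>F n in sequentially. \<forall>y\<in>closure W. norm y \<le> M \<longrightarrow>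
      poly (a n) y \<noteq> 0 \<and> poly (b n) y \<noteq> 0 \<and>
      \<bar>N n * \<alpha> y - ln (norm (poly (a n) y))\<bar> \<le> C \<and> \<bar>N n * \<beta> y - ln (norm (poly (b n) y))\<bar> \<le> C"
    and bd: "\<And>y. y \<in> frontier W \<Longrightarrow> j * \<alpha> y - k * \<beta> y \<le> m"
    and inf: "\<forall>\<^sub>F y in at_infinity. j * \<alpha> y - k * \<beta> y \<le> m"
    and y: "y \<in> W"
  shows "j * \<alpha> y - k * \<beta> y \<le> m"
proof (rule ccontr)
  assume not: "\<not> j * \<alpha> y - k * \<beta> y \<le> m"
  obtain \<rho>0 where \<rho>0: "j * \<alpha> w - k * \<beta> w \<le> m" if "\<rho>0 \<le> norm w" for w
    using inf unfolding eventually_at_infinity by blast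
  \<comment> \<open>Cutting W off at this radius makes the maximum principle applicable: a frontier
    point of S lies on the frontier of W or has norm at least \<rho>, where the assumption at
    infinity applies.\<close>
  define \<rho> where "\<rho> = max \<rho>0 (norm y + 1)"
  define S where "S = W \<inter> ball 0 \<rho>"
  have S: "open S" "bounded S" "y \<in> S"
    using W y by (auto simp: S_def \<rho>_def open_Int bounded_Int)
  have clS: "closure S \<subseteq> closure W" "closure S \<subseteq> cball 0 \<rho>"
    using closure_mono[of S W] closure_minimal[of S "cball 0 \<rho>"] by (force simp: S_def)+
  define E where "E = (real j + real k) * C"
  define T where "T = j * \<alpha> y - k * \<beta> y - m"
  have T: "T > 0" using not by (simp add: T_def)
  \<comment> \<open>Passing between log|f| and N_n (j \<alpha> - k \<beta>) costs E at the frontier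
    and E again at y. A positive gap T is amplified to N_n T, which eventually exceeds 2 E.\<close>
  have "\<forall>\<^sub>F n in sequentially. (2 * E + 1) / T \<le> N n"
    using N by (simp add: filterlim_at_top)
  moreover have "\<forall>\<^sub>F n in sequentially. 0 \<le> N n"
    using N by (simp add: filterlim_at_top)
  ultimately have "\<forall>\<^sub>F n in sequentially. False"
    using approx[of \<rho>]
  proof eventually_elim
    case (elim n)
    have ap: "poly (a n) w \<noteq> 0" "poly (b n) w \<noteq> 0"
      "\<bar>N n * \<alpha> w - ln (norm (poly (a n) w))\<bar> \<le> C" "\<bar>N n * \<beta> w - ln (norm (poly (b n) w))\<bar> \<le> C"
      if "w \<in> closure S" for w
    proof -
      have "w \<in> closure W" "norm w \<le> \<rho>"
        using clS that by auto
      then show "poly (a n) w \<noteq> 0" "poly (b n) w \<noteq> 0"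
        "\<bar>N n * \<alpha> w - ln (norm (poly (a n) w))\<bar> \<le> C" "\<bar>N n * \<beta> w - ln (norm (poly (b n) w))\<bar> \<le> C"
        using elim(3) by blast+
    qed
    define f where "f w = poly (a n) w ^ j / poly (b n) w ^ k" for w
    have norm_f: "norm (f w) = exp (j * ln (norm (poly (a n) w)) - k * ln (norm (poly (b n) w)))"
      and ln_f: "\<bar>N n * (j * \<alpha> w - k * \<beta> w) - (j * ln (norm (poly (a n) w)) - k * ln (norm (poly (b n) w)))\<bar> \<le> E"
      if "w \<in> closure S" for w
    proof -
      show "norm (f w) = exp (j * ln (norm (poly (a n) w)) - k * ln (norm (poly (b n) w)))"
        using ap[OF that] by (simp add: f_def norm_divide norm_power exp_diff exp_of_nat_mult)
      have "\<bar>j * (N n * \<alpha> w - ln (norm (poly (a n) w))) - k * (N n * \<beta> w - ln (norm (poly (b n) w)))\<bar>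
        \<le> j * C + k * C"
        using ap(3,4)[OF that]
        by (intro order_trans[OF abs_triangle_ineq4] add_mono) (auto simp: abs_mult mult_left_mono)
      then show "\<bar>N n * (j * \<alpha> w - k * \<beta> w) - (j * ln (norm (poly (a n) w)) - k * ln (norm (poly (b n) w)))\<bar> \<le> E"
        by (simp add: E_def algebra_simps)
    qed
    have "norm (f y) \<le> exp (N n * m + E)"
    proof (rule maximum_modulus_frontier[of f S])
      have "S \<subseteq> closure S" by (rule closure_subset)
      then show "f holomorphic_on interior S"
        unfolding f_def using S(1) ap by (intro holomorphic_intros) (auto simp: interior_open)
      show "continuous_on (closure S) f"
        unfolding f_def using ap by (intro continuous_intros) auto
      show "norm (f w) \<le> exp (N n * m + E)" if w: "w \<in> frontier S" for w
      proof -
        have wS: "w \<in> closure S" "w \<notin> S"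
          using w S(1) by (auto simp: frontier_def interior_open)
        have "j * \<alpha> w - k * \<beta> w \<le> m"
        proof (cases "w \<in> W")
          case True
          with wS have "norm w \<ge> \<rho>" by (auto simp: S_def)
          then show ?thesis by (intro \<rho>0) (simp add: \<rho>_def)
        next
          case False
          with wS clS W have "w \<in> frontier W" by (auto simp: frontier_def interior_open)
          then show ?thesis by (rule bd)
        qed
        then have "N n * (j * \<alpha> w - k * \<beta> w) \<le> N n * m"
          using elim(2) by (rule mult_left_mono)
        then show ?thesis
          using ln_f[OF wS(1)] unfolding norm_f[OF wS(1)] by simp
      qed
    qed (use S in auto)
    moreover have yS: "y \<in> closure S" using S(3) closure_subset by blast
    ultimately have "N n * (j * \<alpha> y - k * \<beta> y) \<le> N n * m + 2 * E"
      using ln_f[OF yS] unfolding norm_f[OF yS] by simp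
    then have "N n * T \<le> 2 * E"
      by (simp add: T_def algebra_simps)
    moreover have "2 * E + 1 \<le> N n * T"
      using elim(1) T by (simp add: divide_simps)
    ultimately show False by linarith
  qed
  then show False by simp
qed

subsection \<open>The maximum principle on vertical lines\<close>

lemma nonpos_if_nat_multiples_bounded:
  fixes a b :: real
  assumes "\<And>i :: nat. i * a \<le> b"
  shows "a \<le> 0"
  using reals_Archimedean3[of a] assms by (meson not_le)

lemma eventually_ln_norm_ge: "\<forall>\<^sub>F y :: complex in at_infinity. B \<le> ln (norm y)"
proof -
  have "exp B \<le> norm y \<Longrightarrow> B \<le> ln (norm y)" for y :: complex
    by (metis exp_gt_zero less_le_trans ln_ge_iff)
  then show ?thesis
    unfolding eventually_at_infinity by blast
qed

context henon_sequence
begin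

lemma green_vertical: "\<forall>\<^sub>F y in at_infinity. \<bar>green (x, y) - ln (norm y)\<bar> \<le> 2 * K"
proof -
  have "\<bar>green (x, y) - ln (norm y)\<bar> \<le> 2 * K" if "max R (norm x) \<le> norm y" for y
    using escaped_green_bounded[OF escaped_vertical, of y x] that by simp
  then show ?thesis
    unfolding eventually_at_infinity by blast
qed

lemma green_curve:
  assumes "\<not> (degree u = 0 \<and> degree v = 0)" "degree u < n"
  shows "\<exists>C. \<forall>\<^sub>F t in at_infinity.
    \<bar>D n * green (poly u t, poly v t) - degree (orbit_poly p \<delta> u v (Suc n)) * ln (norm t)\<bar> \<le> C"
proof -
  let ?o = "orbit_poly p \<delta> u v (Suc n)"
  have "?o \<noteq> 0"
    using orbit_poly_degree_increasing[OF assms] by auto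
  then obtain C r where C: "\<bar>ln (norm (poly ?o t)) - degree ?o * ln (norm t)\<bar> \<le> C" if "r \<le> norm t" for t
    using ln_norm_poly_growth by blast
  have "\<forall>\<^sub>F t :: complex in at_infinity. r \<le> norm t"
    unfolding eventually_at_infinity by blast
  with curve_eventually_escaped[OF assms]
  have "\<forall>\<^sub>F t in at_infinity.
    \<bar>D n * green (poly u t, poly v t) - degree ?o * ln (norm t)\<bar> \<le> C + 2 * K"
  proof eventually_elim
    case (elim t)
    show ?case
      using escaped_green_bounded[OF elim(1)] C[OF elim(2)] unfolding poly_orbit_poly by linarith
  qed
  then show ?thesis by blast
qed

text \<open>Along the line, G grows like log|y| and G o F like (N / d) log|y|, while both equal c on
  the frontier of W. Two opposite comparisons by the maximum principle give proportionality.\<close>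

lemma green_comparison_on_line:
  assumes F: "polynomial_map2 F" and c: "c > 0"
    and Flt: "\<And>z. green z < c \<Longrightarrow> green (F z) < c" and Fge: "\<And>z. c \<le> green z \<Longrightarrow> c \<le> green (F z)"
    and slice: "\<And>y. F (x, y) = (poly u y, poly v y)"
    and nonconst: "\<not> (degree u = 0 \<and> degree v = 0)" and deg: "degree u < n0"
    and z: "c < green (x, y)"
  shows "D n0 * (green (F (x, y)) - c) = degree (orbit_poly p \<delta> u v (Suc n0)) * (green (x, y) - c)"
proof -
  define \<Omega> where "\<Omega> = {z. green z < c}"
  \<comment> \<open>Removing the closure of the sublevel set, rather than {G <= c}, secures the
    boundary values: continuity gives G o F <= c on that closure, and the reverse inequality holds
    on the closure of W.\<close>
  define W where "W = {y. (x, y) \<notin> closure \<Omega>}"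
  define \<alpha> where "\<alpha> y = green (F (x, y))" for y
  define \<beta> where "\<beta> y = green (x, y)" for y
  define d where "d = D n0"
  define N where "N = degree (orbit_poly p \<delta> u v (Suc n0))"
  have N: "N \<ge> 1"
    using orbit_poly_degree_increasing[OF nonconst deg] by (simp add: N_def)
  have d: "d \<ge> 1"
    using D_pos[of n0] by (simp add: d_def)
  have contF: "continuous_on S F" for S
    using F by (rule continuous_on_polynomial_map2)
  have cont: "continuous_on UNIV (\<lambda>y. (x, y))"
    by (intro continuous_intros)
  have closed_le: "closed {z. green z \<le> c}"
    by (intro closed_Collect_le continuous_on_green continuous_intros)
  have "\<Omega> \<subseteq> {z. green z \<le> c}"
    by (auto simp: \<Omega>_def)
  then have closure_le: "green z \<le> c" if "z \<in> closure \<Omega>" for z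
    using closure_minimal[OF _ closed_le] that by blast
  have "F ` \<Omega> \<subseteq> {z. green z \<le> c}"
    using Flt by (force simp: \<Omega>_def)
  then have F_closure_le: "green (F z) \<le> c" if "z \<in> closure \<Omega>" for z
    using image_closure_subset[OF contF closed_le, of \<Omega>] that by blast
  have "W = UNIV - (\<lambda>y. (x, y)) -` closure \<Omega>"
    by (auto simp: W_def)
  then have W: "open W"
    using closed_vimage[OF closed_closure cont] by (metis open_Diff open_UNIV)
  have W_ge: "c \<le> \<beta> y" if "y \<in> closure W" for y
  proof -
    have "closed {y. c \<le> \<beta> y}"
      unfolding \<beta>_def
      by (intro closed_Collect_le continuous_on_compose2[OF continuous_on_green cont] continuous_intros) auto
    moreover have "W \<subseteq> {y. c \<le> \<beta> y}"
      using closure_subset[of \<Omega>] by (auto simp: W_def \<beta>_def \<Omega>_def not_less[symmetric])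
    ultimately show ?thesis
      using closure_minimal that by blast
  qed
  have \<alpha>_ge: "c \<le> \<alpha> y" if "y \<in> closure W" for y
    using W_ge[OF that] Fge by (simp add: \<alpha>_def \<beta>_def)
  have bd: "\<alpha> y = c" "\<beta> y = c" if "y \<in> frontier W" for y
  proof -
    have "y \<in> closure W" "(x, y) \<in> closure \<Omega>"
      using that W by (auto simp: frontier_def interior_open W_def)
    then show "\<alpha> y = c" "\<beta> y = c"
      using W_ge[of y] \<alpha>_ge[of y] closure_le[of "(x, y)"] F_closure_le[of "(x, y)"]
      by (auto simp: \<alpha>_def \<beta>_def)
  qed
  define a where "a n = orbit_poly p \<delta> u v (Suc n)" for n
  define b where "b n = orbit_poly p \<delta> [:x:] [:0, 1:] (Suc n)" for n
  have pa: "poly (a n) y = \<xi> (F (x, y)) (Suc n)" and pb: "poly (b n) y = \<xi> (x, y) (Suc n)" for n y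
    by (simp_all add: a_def b_def poly_orbit_poly slice)
  have approx: "\<forall>\<^sub>F n in sequentially. \<forall>y\<in>closure W. norm y \<le> M \<longrightarrow>
      poly (a n) y \<noteq> 0 \<and> poly (b n) y \<noteq> 0 \<and>
      \<bar>D n * \<alpha> y - ln (norm (poly (a n) y))\<bar> \<le> 2 * K \<and> \<bar>D n * \<beta> y - ln (norm (poly (b n) y))\<bar> \<le> 2 * K" for M
  proof -
    have "compact ((\<lambda>y. F (x, y)) ` cball 0 M)"
      by (intro compact_continuous_image continuous_on_compose2[OF contF] continuous_intros) auto
    then have "bounded ((\<lambda>y. F (x, y)) ` cball 0 M)"
      by (rule compact_imp_bounded)
    then obtain M1 where "\<forall>y\<in>cball 0 M. norm (F (x, y)) \<le> M1"
      unfolding bounded_iff by blast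
    then have M1: "norm (F (x, y)) \<le> M1" if "norm y \<le> M" for y
      using that by simp
    have M2: "norm (x, y) \<le> norm x + M" if "norm y \<le> M" for y
      using norm_Pair_le[of x y] that by linarith
    show ?thesis
      using eventually_escaped[OF c, of M1] eventually_escaped[OF c, of "norm x + M"]
    proof eventually_elim
      case (elim n)
      show ?case
      proof (intro ballI impI)
        fix y assume y: "y \<in> closure W" "norm y \<le> M"
        have "escaped (F (x, y)) n" "escaped (x, y) n"
          using elim y W_ge[of y] \<alpha>_ge[of y] M1[of y] M2[of y] unfolding \<alpha>_def \<beta>_def by blast+
        then show "poly (a n) y \<noteq> 0 \<and> poly (b n) y \<noteq> 0 \<and>
           \<bar>D n * \<alpha> y - ln (norm (poly (a n) y))\<bar> \<le> 2 * K \<and> \<bar>D n * \<beta> y - ln (norm (poly (b n) y))\<bar> \<le> 2 * K"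
          unfolding pa pb \<alpha>_def \<beta>_def using escaped_green_bounded escaped_ge_1 by fastforce
      qed
    qed
  qed
  then have approx': "\<forall>\<^sub>F n in sequentially. \<forall>y\<in>closure W. norm y \<le> M \<longrightarrow>
      poly (b n) y \<noteq> 0 \<and> poly (a n) y \<noteq> 0 \<and>
      \<bar>D n * \<beta> y - ln (norm (poly (b n) y))\<bar> \<le> 2 * K \<and> \<bar>D n * \<alpha> y - ln (norm (poly (a n) y))\<bar> \<le> 2 * K" for M
    by (rule eventually_mono) blast
  obtain C where C: "\<forall>\<^sub>F y in at_infinity. \<bar>d * \<alpha> y - N * ln (norm y)\<bar> \<le> C"
    using green_curve[OF nonconst deg] by (auto simp: d_def N_def \<alpha>_def slice)
  have K: "\<forall>\<^sub>F y in at_infinity. \<bar>\<beta> y - ln (norm y)\<bar> \<le> 2 * K"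
    unfolding \<beta>_def by (rule green_vertical)
  have yW: "y \<in> W"
    using closure_le[of "(x, y)"] z by (force simp: W_def)
  \<comment> \<open>The exponents \<open>i d\<close> and \<open>i N\<close> would balance exactly at infinity; the additional \<open>1\<close> forces decay
    there and disappears as \<open>i\<close> tends to infinity.\<close>
  have "i * (d * (\<alpha> y - c) - N * (\<beta> y - c)) \<le> \<beta> y - c" for i :: nat
  proof -
    let ?m = "(real (i * d) - real (i * N + 1)) * c"
    have "real (i * d) * \<alpha> y - real (i * N + 1) * \<beta> y \<le> ?m"
    proof (rule subharmonic_comparison[OF W D_at_top approx])
      show "real (i * d) * \<alpha> y - real (i * N + 1) * \<beta> y \<le> ?m" if "y \<in> frontier W" for y
        unfolding bd[OF that] by (simp add: algebra_simps)
      show "\<forall>\<^sub>F y in at_infinity. real (i * d) * \<alpha> y - real (i * N + 1) * \<beta> y \<le> ?m"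
        using C K eventually_ln_norm_ge[of "i * C + real (i * N + 1) * (2 * K) - ?m"]
      proof eventually_elim
        case (elim y)
        have "real i * (d * \<alpha> y) \<le> real i * (N * ln (norm y) + C)"
          using elim(1) by (intro mult_left_mono) auto
        moreover have "real (i * N + 1) * (ln (norm y) - 2 * K) \<le> real (i * N + 1) * \<beta> y"
          using elim(2) by (intro mult_left_mono) auto
        ultimately show ?case
          using elim(3) by (simp add: algebra_simps)
      qed
    qed (rule yW)
    then show ?thesis by (simp add: algebra_simps)
  qed
  then have le: "d * (\<alpha> y - c) - N * (\<beta> y - c) \<le> 0"
    by (rule nonpos_if_nat_multiples_bounded)
  have "i * (N * (\<beta> y - c) - d * (\<alpha> y - c)) \<le> \<alpha> y - c" for i :: nat
  proof -
    let ?m = "(real (i * N) - real (i * d + 1)) * c"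
    have "real (i * N) * \<beta> y - real (i * d + 1) * \<alpha> y \<le> ?m"
    proof (rule subharmonic_comparison[OF W D_at_top approx'])
      show "real (i * N) * \<beta> y - real (i * d + 1) * \<alpha> y \<le> ?m" if "y \<in> frontier W" for y
        unfolding bd[OF that] by (simp add: algebra_simps)
      \<comment> \<open>The surplus factor is now \<alpha>. It still tends to infinity, because N >=
        1 gives d \<alpha> >= log|y| - C for large |y|.\<close>
      let ?B = "real (i * N) * (2 * K) + i * C - ?m"
      show "\<forall>\<^sub>F y in at_infinity. real (i * N) * \<beta> y - real (i * d + 1) * \<alpha> y \<le> ?m"
        using C K eventually_ln_norm_ge[of "d * \<bar>?B\<bar> + C"] eventually_ln_norm_ge[of 0]
      proof eventually_elim
        case (elim y)
        have "1 * ln (norm y) \<le> N * ln (norm y)"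
          using N elim(4) by (intro mult_right_mono) auto
        then have "d * \<bar>?B\<bar> \<le> d * \<alpha> y"
          using elim(1,3) by linarith
        then have "?B \<le> \<alpha> y"
          using d by simp
        moreover have "real (i * N) * \<beta> y \<le> real (i * N) * (ln (norm y) + 2 * K)"
          using elim(2) by (intro mult_left_mono) auto
        moreover have "real i * (N * ln (norm y) - C) \<le> real i * (d * \<alpha> y)"
          using elim(1) by (intro mult_left_mono) auto
        ultimately show ?case
          by (simp add: algebra_simps)
      qed
    qed (rule yW)
    then show ?thesis by (simp add: algebra_simps)
  qed
  then have "N * (\<beta> y - c) - d * (\<alpha> y - c) \<le> 0"
    by (rule nonpos_if_nat_multiples_bounded)
  with le show ?thesis
    by (simp add: d_def N_def \<alpha>_def \<beta>_def)
qed

text \<open>Injectivity prevents a vertical line from collapsing to a point. The degree in y of the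
  first component bounds all deg (u x) at once, so one index n serves every line.\<close>

lemma polynomial_map2_slices:
  assumes "polynomial_map2 F" "inj F"
  shows "\<exists>u v n. (\<forall>x y. F (x, y) = (poly (u x) y, poly (v x) y)) \<and> (\<forall>x. degree (u x) < n) \<and>
    (\<forall>x. \<not> (degree (u x) = 0 \<and> degree (v x) = (0 :: nat)))"
proof -
  obtain P where P: "\<And>x y. fst (F (x, y)) = poly (poly_slice x P) y"
    using assms(1) unfolding polynomial_map2_def polynomial_function2_iff_slice comp_def by auto
  obtain Q where Q: "\<And>x y. snd (F (x, y)) = poly (poly_slice x Q) y"
    using assms(1) unfolding polynomial_map2_def polynomial_function2_iff_slice comp_def by auto
  have F: "F (x, y) = (poly (poly_slice x P) y, poly (poly_slice x Q) y)" for x y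
    by (simp add: prod_eq_iff P Q)
  have "\<not> (degree (poly_slice x P) = 0 \<and> degree (poly_slice x Q) = 0)" for x
  proof
    assume "degree (poly_slice x P) = 0 \<and> degree (poly_slice x Q) = 0"
    then have 0: "degree (poly_slice x P) = 0" "degree (poly_slice x Q) = 0" by auto
    obtain a where "poly_slice x P = [:a:]" using 0(1) by (rule degree_eq_zeroE)
    moreover obtain b where "poly_slice x Q = [:b:]" using 0(2) by (rule degree_eq_zeroE)
    ultimately have "F (x, 0) = F (x, 1)"
      by (simp add: F)
    from injD[OF assms(2) this] show False by simp
  qed
  moreover have "degree (poly_slice x P) < Suc (degree P)" for x
    using degree_poly_slice_le le_imp_less_Suc by blast
  ultimately show ?thesis
    using F by (intro exI[of _ "\<lambda>x. poly_slice x P"] exI[of _ "\<lambda>x. poly_slice x Q"] exI[of _ "Suc (degree P)"]) simp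
qed

text \<open>The multiplier on the line over x is N x / D_n0. Near x0, at a fixed y with G (x0, y) >
  c, the integer N x equals a quotient of functions continuous in x; so N is continuous with
  discrete values, hence constant.\<close>

proposition green_affine_relation:
  assumes F: "polynomial_map2 F" "inj F" and c: "c > 0"
    and Flt: "\<And>z. green z < c \<Longrightarrow> green (F z) < c" and Fge: "\<And>z. c \<le> green z \<Longrightarrow> c \<le> green (F z)"
  shows "\<exists>A>0. \<forall>z. c < green z \<longrightarrow> green (F z) - c = A * (green z - c)"
proof -
  obtain u v n0 where slice: "\<And>x y. F (x, y) = (poly (u x) y, poly (v x) y)"
    and deg: "\<And>x. degree (u x) < n0" and nc: "\<And>x. \<not> (degree (u x) = 0 \<and> degree (v x) = 0)"
    using polynomial_map2_slices[OF F] by metis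
  define N where "N x = degree (orbit_poly p \<delta> (u x) (v x) (Suc n0))" for x
  have rel: "D n0 * (green (F (x, y)) - c) = N x * (green (x, y) - c)" if "c < green (x, y)" for x y
    unfolding N_def by (rule green_comparison_on_line[OF F(1) c Flt Fge slice nc deg that])
  have "continuous_on UNIV (\<lambda>x. real (N x))"
    unfolding continuous_on_eq_continuous_at[OF open_UNIV]
  proof
    fix x0 :: complex
    have "\<forall>\<^sub>F y in at_infinity. c < green (x0, y)"
      using green_vertical[of x0] eventually_ln_norm_ge[of "2 * K + c + 1"]
      by eventually_elim linarith
    then obtain y where y: "c < green (x0, y)"
      using eventually_happens'[OF trivial_limit_at_infinity] by blast
    have "continuous_on UNIV (\<lambda>x. green (x, y))"
      by (intro continuous_on_compose2[OF continuous_on_green] continuous_intros) auto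
    then have g: "isCont (\<lambda>x. green (x, y)) x0"
      by (simp add: continuous_on_eq_continuous_at)
    have "continuous_on UNIV (\<lambda>x. green (F (x, y)))"
      by (intro continuous_on_compose2[OF continuous_on_green]
          continuous_on_compose2[OF continuous_on_polynomial_map2[OF F(1)]] continuous_intros) auto
    then have gF: "isCont (\<lambda>x. green (F (x, y))) x0"
      by (simp add: continuous_on_eq_continuous_at)
    have "\<forall>\<^sub>F x in nhds x0. c < green (x, y)"
      using order_tendstoD(1)[OF g[unfolded isCont_def, THEN tendsto_at_iff_tendsto_nhds[THEN iffD1]] y] .
    then have ev: "\<forall>\<^sub>F x in nhds x0. D n0 * (green (F (x, y)) - c) / (green (x, y) - c) = N x"
      by eventually_elim (use rel in auto)
    have "isCont (\<lambda>x. D n0 * (green (F (x, y)) - c) / (green (x, y) - c)) x0"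
      using y by (intro continuous_intros g gF) auto
    then show "isCont (\<lambda>x. real (N x)) x0"
      using isCont_cong[OF ev] by simp
  qed
  then have "(\<lambda>x. real (N x)) constant_on UNIV"
  proof (rule continuous_discrete_range_constant[OF connected_UNIV])
    fix x :: complex
    show "\<exists>e>0. \<forall>y. y \<in> UNIV \<and> real (N y) \<noteq> real (N x) \<longrightarrow> e \<le> norm (real (N y) - real (N x))"
      by (intro exI[of _ 1]) auto
  qed
  then obtain A where A: "real (N x) = A" for x
    by (auto simp: constant_on_def)
  have "A > 0"
    using orbit_poly_degree_increasing[OF nc[of 0] deg[of 0]] A[of 0] by (simp add: N_def)
  have "green (F z) - c = A / D n0 * (green z - c)" if "c < green z" for z
    using rel[of "fst z" "snd z"] that D_pos[of n0] by (simp add: A field_simps)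
  then show ?thesis
    using \<open>A > 0\<close> D_pos[of n0] by (intro exI[of _ "A / D n0"]) auto
qed

end

subsection \<open>Rigidity of translations of the Green function\<close>

lemma abs_exp_minus_1_le: "\<bar>exp t - 1\<bar> \<le> \<bar>t\<bar> * exp \<bar>t\<bar>" for t :: real
proof (cases "t \<ge> 0")
  case True
  have "exp t * (1 - t) \<le> exp t * exp (- t)"
    using exp_ge_add_one_self[of "- t"] by (intro mult_left_mono) auto
  then show ?thesis
    using True by (simp add: algebra_simps flip: exp_add)
next
  case False
  have "\<bar>exp t - 1\<bar> \<le> \<bar>t\<bar> * 1"
    using False exp_ge_add_one_self[of t] exp_le_one_iff[of t] by linarith
  also have "\<dots> \<le> \<bar>t\<bar> * exp \<bar>t\<bar>"
    by (intro mult_left_mono) auto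
  finally show ?thesis .
qed

text \<open>Iterating gives p(n h) = p(0) + n e for all natural n, so t -> p(h t) would agree with
  an affine polynomial at infinitely many points.\<close>

lemma poly_const_increment_imp_0:
  fixes p :: "complex poly"
  assumes deg: "2 \<le> degree p" and inc: "\<And>t. poly p (t + h) = poly p t + e"
  shows "h = 0"
proof (rule ccontr)
  assume h: "h \<noteq> 0"
  define q where "q = pcompose p [:0, h:] - [:poly p 0, e:]"
  have "poly p (of_nat n * h) = poly p 0 + of_nat n * e" for n
  proof (induction n)
    case (Suc n)
    have "of_nat (Suc n) * h = of_nat n * h + h" by (simp add: algebra_simps)
    then show ?case using inc[of "of_nat n * h"] Suc by (simp add: algebra_simps)
  qed simp
  then have "poly q (of_nat n) = 0" for n
    by (simp add: q_def poly_pcompose)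
  then have "range of_nat \<subseteq> {x. poly q x = 0}" by auto
  then have "infinite {x. poly q x = 0}"
    using range_inj_infinite[OF inj_of_nat] finite_subset by blast
  then have "q = 0"
    using poly_roots_finite by blast
  then have "pcompose p [:0, h:] = [:poly p 0, e:]"
    by (simp add: q_def)
  then have "degree (pcompose p [:0, h:]) \<le> 1"
    by simp
  then show False
    using deg h by (simp add: degree_pcompose)
qed

text \<open>Compare the coefficients of degree deg p; neither w nor e contributes to them.\<close>

lemma affine_symmetry_lead:
  fixes p :: "complex poly"
  assumes "2 \<le> degree p" "C \<noteq> 0" "B \<noteq> 0"
    and eq: "\<And>t. poly p (C * t + w) = B * poly p t + e"
  shows "C ^ degree p = B"
proof -
  have "pcompose p [:w, C:] = smult B p + [:e:]"
    using eq by (intro poly_ext) (simp add: poly_pcompose algebra_simps)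
  then have "coeff (pcompose p [:w, C:]) (degree p) = B * lead_coeff p"
    using assms(1) by (simp add: coeff_pCons split: nat.splits)
  moreover have "lead_coeff (pcompose p [:w, C:]) = lead_coeff p * C ^ degree p"
    using assms(2) by (subst lead_coeff_comp) auto
  moreover have "degree (pcompose p [:w, C:]) = degree p"
    using assms(2) by (simp add: degree_pcompose)
  moreover have "lead_coeff p \<noteq> 0"
    using assms(1) by auto
  ultimately show ?thesis by simp
qed

context henon_sequence
begin

text \<open>Solve the recurrence backwards for its oldest term. The result gives surjectivity of the
  pair of consecutive entries and, after a full period, a polynomial inverse of the Henon
  map.\<close>

lemma polynomial_right_inverse_orbit:
  "\<exists>G. polynomial_map2 G \<and> (\<forall>z. \<xi> (G z) n = fst z \<and> \<xi> (G z) (Suc n) = snd z)"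
proof (induction n)
  case 0
  have "polynomial_map2 (\<lambda>z. z)"
    using polynomial_function2_fst polynomial_function2_snd by (simp add: polynomial_map2_def comp_def)
  then show ?case
    by (intro exI[of _ "\<lambda>z. z"]) simp
next
  case (Suc n)
  then obtain G where G: "polynomial_map2 G"
    "\<And>z. \<xi> (G z) n = fst z" "\<And>z. \<xi> (G z) (Suc n) = snd z"
    by blast
  define E :: "complex \<times> complex \<Rightarrow> complex \<times> complex"
    where "E z = (inverse (\<delta> n) * (poly (p n) (fst z) - snd z), fst z)" for z
  have "polynomial_map2 E"
    by (auto simp: polynomial_map2_def comp_def E_def intro!: polynomial_function2_mult
        polynomial_function2_const polynomial_function2_diff polynomial_function2_poly
        polynomial_function2_fst polynomial_function2_snd)
  with G(1) have "polynomial_map2 (\<lambda>z. G (E z))"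
    by (rule polynomial_map2_compose)
  then show ?case
    using delta_nonzero[of n]
    by (intro exI[of _ "\<lambda>z. G (E z)"]) (simp add: G E_def henon_orbit.simps(3) flip: mult.assoc)
qed

lemma surj_orbit_pair: "\<exists>z. \<xi> z n = X \<and> \<xi> z (Suc n) = Y"
  using polynomial_right_inverse_orbit[of n] by (metis fst_conv snd_conv)

lemma inj_orbit_pair:
  "\<xi> z n = \<xi> z' n \<Longrightarrow> \<xi> z (Suc n) = \<xi> z' (Suc n) \<Longrightarrow> z = z'"
proof (induction n)
  case 0
  then show ?case by (simp add: prod_eq_iff)
next
  case (Suc n)
  then show ?case
    using delta_nonzero[of n] by (simp add: henon_orbit.simps(3))
qed

text \<open>On each vertical line the asymptotics of G make |xi_(n+1) o F| - \<rho> |xi_(n+1)|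
  bounded near infinity, with a bound independent of x. This gives an affine relation on every line,
  and Liouville's theorem removes the dependence of its coefficients on x.\<close>

lemma green_translation_imp_affine_orbit:
  fixes \<kappa> :: real
  assumes F: "polynomial_map2 F" "inj F" and rel: "\<And>z. s < green z \<Longrightarrow> green (F z) = green z + \<kappa>"
  shows "\<exists>n0. \<forall>n\<ge>n0. \<exists>C w. norm C = exp (D n * \<kappa>) \<and> (\<forall>z. \<xi> (F z) (Suc n) = C * \<xi> z (Suc n) + w)"
proof -
  obtain u v n0 where slice: "\<And>x y. F (x, y) = (poly (u x) y, poly (v x) y)"
    and deg: "\<And>x. degree (u x) < n0" and nc: "\<And>x. \<not> (degree (u x) = 0 \<and> degree (v x) = 0)"
    using polynomial_map2_slices[OF F] by metis
  have "\<exists>C w. norm C = exp (D n * \<kappa>) \<and> (\<forall>z. \<xi> (F z) (Suc n) = C * \<xi> z (Suc n) + w)" if n: "n0 \<le> n" for n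
  proof -
    define \<rho> where "\<rho> = exp (D n * \<kappa>)"
    define K1 where "K1 = K + K * exp (2 * K) / \<rho>"
    define V where "V x = orbit_poly p \<delta> (u x) (v x) (Suc n)" for x
    define Y where "Y x = orbit_poly p \<delta> [:x:] [:0, 1:] (Suc n)" for x
    have V: "poly (V x) y = \<xi> (F (x, y)) (Suc n)" and Y: "poly (Y x) y = \<xi> (x, y) (Suc n)" for x y
      by (simp_all add: V_def Y_def poly_orbit_poly slice)
    have \<rho>: "\<rho> > 0" by (simp add: \<rho>_def)
    have degn: "degree (u x) < n" for x using deg[of x] n by simp
    have "\<exists>C w. V x = smult C (Y x) + [:w:] \<and> norm C = \<rho> \<and> norm w \<le> \<rho> * K1 * exp (2 * K)" for x
    proof -
      have "\<forall>\<^sub>F y :: complex in at_infinity. max R (norm x) \<le> norm y"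
        unfolding eventually_at_infinity by blast
      moreover have "\<forall>\<^sub>F y in at_infinity. escaped (F (x, y)) n"
        unfolding slice by (rule curve_eventually_escaped[OF nc degn])
      ultimately have "\<forall>\<^sub>F y in at_infinity.
          \<bar>norm (poly (V x) y) - \<rho> * norm (poly (Y x) y)\<bar> \<le> \<rho> * K1 * exp (2 * K)"
        using green_vertical[of x] eventually_ln_norm_ge[of "s + 2 * K + 1"]
      proof eventually_elim
        case (elim y)
        define a where "a = norm (poly (V x) y)"
        define b where "b = norm (poly (Y x) y)"
        \<comment> \<open>The logarithmic error, so that a = \<rho> b exp t. It is at most K / a + K
          / b; since a >= \<rho> b exp (-2 K), this is at most \<open>K1 / b\<close>, which keeps b
          |exp t - 1| bounded.\<close>
        define t where "t = ln a - ln b - D n * \<kappa>"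
        have "escaped (x, y) 0" using elim(1) by (intro escaped_vertical) auto
        then have ey: "escaped (x, y) n" by (rule escaped_mono) simp
        have a1: "1 \<le> a" and b1: "1 \<le> b"
          using escaped_ge_1[OF elim(2)] escaped_ge_1[OF ey] by (simp_all add: a_def b_def V Y)
        have "s < green (x, y)" using elim(3,4) by linarith
        then have g: "D n * green (F (x, y)) = D n * green (x, y) + D n * \<kappa>"
          using rel by (simp add: algebra_simps)
        have "\<bar>t\<bar> \<le> K / a + K / b"
          using escaped_green[OF elim(2)] escaped_green[OF ey] g
          unfolding t_def a_def b_def V Y by linarith
        moreover have "K / a \<le> K" "K / b \<le> K"
          using a1 b1 K_nonneg by (auto simp: divide_le_eq mult_le_cancel_left1)
        ultimately have t2: "\<bar>t\<bar> \<le> 2 * K" by linarith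
        have "exp (ln a) = exp (t + ln b + D n * \<kappa>)"
          by (simp add: t_def)
        then have a: "a = \<rho> * b * exp t"
          using a1 b1 by (simp add: exp_add \<rho>_def)
        have "exp (- (2 * K)) \<le> exp t" using t2 by simp
        then have "\<rho> * b * exp (- (2 * K)) \<le> a"
          unfolding a using \<rho> b1 by (intro mult_left_mono) auto
        then have "K / a \<le> K / (\<rho> * b * exp (- (2 * K)))"
          using \<rho> b1 a1 K_nonneg by (intro divide_left_mono) auto
        also have "\<dots> = K * exp (2 * K) / \<rho> / b"
          by (simp add: exp_minus field_simps)
        finally have "K / a + K / b \<le> K1 / b"
          by (simp add: K1_def add_divide_distrib)
        with \<open>\<bar>t\<bar> \<le> K / a + K / b\<close> have "\<bar>t\<bar> \<le> K1 / b" by linarith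
        then have t1: "b * \<bar>t\<bar> \<le> K1" using b1 by (simp add: field_simps)
        have "\<bar>a - \<rho> * b\<bar> = \<rho> * b * \<bar>exp t - 1\<bar>"
          unfolding a using \<rho> b1 by (simp add: abs_mult flip: right_diff_distrib[of "\<rho> * b" "exp t" 1, simplified])
        also have "\<dots> \<le> \<rho> * b * (\<bar>t\<bar> * exp \<bar>t\<bar>)"
          using \<rho> b1 by (intro mult_left_mono abs_exp_minus_1_le) auto
        also have "\<dots> = \<rho> * ((b * \<bar>t\<bar>) * exp \<bar>t\<bar>)" by simp
        also have "\<dots> \<le> \<rho> * (K1 * exp (2 * K))"
          using \<rho> t1 t2 K_nonneg by (intro mult_left_mono mult_mono) (auto simp: K1_def)
        finally show ?case by (simp add: a_def b_def)
      qed
      then obtain r where r: "\<bar>norm (poly (V x) y) - \<rho> * norm (poly (Y x) y)\<bar> \<le> \<rho> * K1 * exp (2 * K)"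
        if "r \<le> norm y" for y
        unfolding eventually_at_infinity by blast
      have "1 \<le> degree (Y x)"
        using vertical_orbit_poly(1)[of x n] D_pos[of n] by (simp add: Y_def)
      then show ?thesis
        using \<rho> r by (rule poly_norm_proportional_imp_affine)
    qed
    then obtain C w where Cw: "\<And>x. V x = smult (C x) (Y x) + [:w x:]"
      and C: "\<And>x. norm (C x) = \<rho>" and w: "\<And>x. norm (w x) \<le> \<rho> * K1 * exp (2 * K)"
      by metis
    \<comment> \<open>Reading off the coefficient of y^(D n) shows that C(x) times a constant is a
      polynomial in x, bounded and hence constant. The coefficient of y^0 then does the same for
      w.\<close>
    obtain P where P: "\<And>x y. \<xi> (F (x, y)) (Suc n) = poly (poly_slice x P) y"
      using polynomial_function2_compose[OF polynomial_function2_orbit F(1)]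
      unfolding polynomial_function2_iff_slice by blast
    obtain Q where Q: "\<And>x y. \<xi> (x, y) (Suc n) = poly (poly_slice x Q) y"
      using polynomial_function2_orbit unfolding polynomial_function2_iff_slice by blast
    have VP: "poly_slice x P = V x" and YQ: "poly_slice x Q = Y x" for x
      by (intro poly_ext; simp add: V Y P Q)+
    have lead: "poly (coeff P (D n)) x = C x * vertical_lead n" for x
    proof -
      have "coeff (V x) (D n) = C x * vertical_lead n"
        using vertical_orbit_poly[of x n] D_pos[of n]
        by (simp add: Cw Y_def coeff_pCons split: nat.splits)
      then show ?thesis
        by (simp flip: VP add: coeff_poly_slice)
    qed
    have "vertical_lead n \<noteq> 0"
      using vertical_orbit_poly[of 0 n] D_pos[of n] by (metis degree_0 leading_coeff_neq_0 less_irrefl)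
    moreover have "poly (coeff P (D n)) x = poly (coeff P (D n)) 0" for x
      by (rule bounded_poly_constant[where B = "\<rho> * norm (vertical_lead n)"]) (simp add: lead norm_mult C)
    ultimately have Cc: "C x = C 0" for x
      unfolding lead by simp
    have w_poly: "poly (coeff P 0 - smult (C 0) (coeff Q 0)) x = w x" for x
      by (simp flip: coeff_poly_slice add: VP YQ Cw Cc[of x])
    have wc: "w x = w 0" for x
      using bounded_poly_constant[of "coeff P 0 - smult (C 0) (coeff Q 0)" _ x] w unfolding w_poly by blast
    have "\<xi> (F (x, y)) (Suc n) = C 0 * \<xi> (x, y) (Suc n) + w 0" for x y
      unfolding V[symmetric] Y[symmetric] Cw Cc[of x] wc[of x] by simp
    then show ?thesis
      using C[of 0] by (intro exI[of _ "C 0"] exI[of _ "w 0"]) (auto simp: \<rho>_def)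
  qed
  then show ?thesis by blast
qed

end

section \<open>Periodic sequences and their symmetries\<close>

locale periodic_henon_sequence = henon_sequence +
  fixes k :: nat
  assumes period_pos: "0 < k"
    and poly_periodic: "p (n + k) = p n" and delta_periodic: "\<delta> (n + k) = \<delta> n"
begin

lemma poly_periodic_mult: "p (n + k * q) = p n" and delta_periodic_mult: "\<delta> (n + k * q) = \<delta> n"
proof (induction q)
  case (Suc q)
  have "n + k * Suc q = n + k * q + k" by simp
  then show "p (n + k * Suc q) = p n" "\<delta> (n + k * Suc q) = \<delta> n"
    using Suc poly_periodic delta_periodic by metis+
qed auto

lemma orbit_shift: "\<xi> z (n + k * q) = \<xi> (\<xi> z (k * q), \<xi> z (Suc (k * q))) n"
  by (induction n rule: induct_nat_012)
    (auto simp: henon_orbit.simps(3) poly_periodic_mult delta_periodic_mult)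

lemma D_shift: "D (n + k * q) = D n * D (k * q)"
  by (induction n) (auto simp: D_Suc poly_periodic_mult)

text \<open>Whole periods do not change the remaining factors, so the levels at the shifted point
  are a rescaled tail of those at z. This is the functional equation G o H^q = d^q G.\<close>

lemma green_shift: "green (\<xi> z (k * q), \<xi> z (Suc (k * q))) = D (k * q) * green z"
proof -
  have "level n (\<xi> z (k * q), \<xi> z (Suc (k * q))) = D (k * q) * level (n + k * q) z" for n
    using orbit_shift[of z n q] orbit_shift[of z "Suc n" q] D_pos[of "k * q"]
    by (simp add: level_def D_shift)
  moreover have "(\<lambda>n. D (k * q) * level (n + k * q) z) \<longlonglongrightarrow> D (k * q) * green z"
    by (intro tendsto_mult tendsto_const LIMSEQ_ignore_initial_segment level_tendsto_green)
  ultimately show ?thesis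
    using level_tendsto_green LIMSEQ_unique by (metis (no_types, lifting) ext)
qed

proposition green_translation_rigid:
  fixes \<kappa> :: real
  assumes F: "polynomial_map2 F" "inj F" and rel: "\<And>z. s < green z \<Longrightarrow> green (F z) = green z + \<kappa>"
  shows "\<kappa> = 0 \<and> (\<exists>\<alpha> \<beta> f g. \<forall>x y. F (x, y) = (\<alpha> * x + f, \<beta> * y + g))"
proof -
  obtain n0 C' w' where C': "\<And>n. n \<ge> n0 \<Longrightarrow> norm (C' n) = exp (D n * \<kappa>)"
    and w': "\<And>n z. n \<ge> n0 \<Longrightarrow> \<xi> (F z) (Suc n) = C' n * \<xi> z (Suc n) + w' n"
    using green_translation_imp_affine_orbit[OF F rel] by metis
  \<comment> \<open>The relations known so far concern index n + 1; the shift lets C_n and w_n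
    belong to xi_n itself, for n > n0.\<close>
  define C where "C n = C' (n - 1)" for n
  define w where "w n = w' (n - 1)" for n
  have normC: "norm (C n) = exp (D (n - 1) * \<kappa>)"
    and aff: "\<xi> (F z) n = C n * \<xi> z n + w n" if "n > n0" for n z
  proof -
    have "n0 \<le> n - 1" "Suc (n - 1) = n" using that by auto
    then show "norm (C n) = exp (D (n - 1) * \<kappa>)" "\<xi> (F z) n = C n * \<xi> z n + w n"
      using C'[of "n - 1"] w'[of "n - 1" z] by (simp_all add: C_def w_def)
  qed
  have C0: "C n \<noteq> 0" if "n > n0" for n
    using normC[OF that] by auto
  have rec: "C (Suc (Suc n)) = C n \<and> (\<exists>e. \<forall>t. poly (p n) (C (Suc n) * t + w (Suc n)) = C n * poly (p n) t + e)"
    if n: "n > n0" for n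
  proof -
    \<comment> \<open>Consecutive entries take all values in the plane, so the recurrence becomes an
      identity in independent X and Y. Its X-coefficient yields C_(n+2) = C_n.\<close>
    have eq: "C (Suc (Suc n)) * (poly (p n) Y - \<delta> n * X) + w (Suc (Suc n)) =
      poly (p n) (C (Suc n) * Y + w (Suc n)) - \<delta> n * (C n * X + w n)" for X Y
    proof -
      obtain z where z: "\<xi> z n = X" "\<xi> z (Suc n) = Y"
        using surj_orbit_pair by blast
      show ?thesis
        using aff[of "Suc (Suc n)" z] aff[of "Suc n" z] aff[of n z] n z
        by (simp add: henon_orbit.simps(3))
    qed
    have "\<delta> n * (C (Suc (Suc n)) - C n) = 0"
      using eq[of 0 0] eq[of 0 1] by algebra
    then have "C (Suc (Suc n)) = C n"
      using delta_nonzero[of n] by simp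
    moreover have "poly (p n) (C (Suc n) * t + w (Suc n)) =
        C n * poly (p n) t + (w (Suc (Suc n)) + \<delta> n * w n)" for t
      using eq[of t 0] \<open>C (Suc (Suc n)) = C n\<close> by (simp add: algebra_simps)
    ultimately show ?thesis by blast
  qed
  have lead: "C (Suc n) ^ degree (p n) = C n" if n: "n > n0" for n
  proof -
    obtain e where "\<And>t. poly (p n) (C (Suc n) * t + w (Suc n)) = C n * poly (p n) t + e"
      using rec[OF n] by blast
    then show ?thesis
      using degree_ge_2 C0[of n] C0[of "Suc n"] n by (intro affine_symmetry_lead[of "p n" _ _ "w (Suc n)" e]) auto
  qed
  \<comment> \<open>Two steps give C_n = C_n^d with d a product of two degrees, so the nonzero C_n
    is a root of unity.\<close>
  have norm1: "norm (C n) = 1" if n: "n > n0" for n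
  proof -
    define d where "d = degree (p (Suc n)) * degree (p n)"
    have d: "2 * 2 \<le> d"
      unfolding d_def by (intro mult_mono degree_ge_2) auto
    have "C n = C n ^ d"
      using lead[OF n] lead[of "Suc n"] rec[OF n] n by (simp add: d_def power_mult)
    then have "norm (C n) = norm (C n) ^ d"
      by (metis norm_power)
    then have "norm (C n) * (norm (C n) ^ (d - 1) - 1) = 0"
      using d by (simp add: right_diff_distrib flip: power_Suc)
    then have "norm (C n) ^ (d - 1) = 1"
      using C0[OF n] by simp
    then show ?thesis
      using d power_eq_iff_eq_base[of "d - 1" "norm (C n)" 1] by simp
  qed
  have "exp (D n0 * \<kappa>) = 1"
    using normC[of "Suc n0"] norm1[of "Suc n0"] by simp
  then have \<kappa>: "\<kappa> = 0"
    using D_pos[of n0] by simp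
  have C_per: "C (n + 2 * i) = C n" if "n > n0" for n i
    by (induction i) (use rec that in auto)
  \<comment> \<open>The shift is a multiple of k, which restores p, and of 2, which restores C. Both
    w's then satisfy a relation with the same polynomial and multipliers, so their difference is an
    increment changing p only by a constant, hence 0.\<close>
  have w_per: "w (Suc n + k * (2 * i)) = w (Suc n)" if n: "n > n0" for n i
  proof -
    let ?m = "n + k * (2 * i)"
    have per: "C ?m = C n" "C (Suc ?m) = C (Suc n)"
      using C_per[of n "k * i"] C_per[of "Suc n" "k * i"] n by (simp_all add: mult.left_commute)
    obtain e where e: "\<And>t. poly (p n) (C (Suc n) * t + w (Suc n)) = C n * poly (p n) t + e"
      using rec[OF n] by blast
    obtain e' where e': "\<And>t. poly (p n) (C (Suc n) * t + w (Suc ?m)) = C n * poly (p n) t + e'"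
      using rec[of ?m] n per unfolding poly_periodic_mult by auto
    have "w (Suc ?m) - w (Suc n) = 0"
    proof (rule poly_const_increment_imp_0[OF degree_ge_2[of n]])
      fix t
      define T where "T = (t - w (Suc n)) / C (Suc n)"
      have T: "C (Suc n) * T = t - w (Suc n)"
        using C0[of "Suc n"] n by (simp add: T_def)
      have "poly (p n) (C (Suc n) * T + w (Suc ?m)) = poly (p n) (C (Suc n) * T + w (Suc n)) + (e' - e)"
        unfolding e e' by simp
      then show "poly (p n) (t + (w (Suc ?m) - w (Suc n))) = poly (p n) t + (e' - e)"
        unfolding T by (simp add: algebra_simps)
    qed
    then show ?thesis by simp
  qed
  \<comment> \<open>With H the map given by one period, S q is the iterate of H of order 2
    q.\<close>
  define S where "S q z = (\<xi> z (k * (2 * q)), \<xi> z (Suc (k * (2 * q))))" for q z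
  have S_add: "S (q + r) z = S q (S r z)" for q r z
    using orbit_shift[of z "k * (2 * q)" "2 * r"] orbit_shift[of z "Suc (k * (2 * q))" "2 * r"]
    by (simp add: S_def algebra_simps)
  \<comment> \<open>This makes m at least n0 + 2, so that \<open>w_per\<close> can be applied at m -
    1 > n0.\<close>
  define q where "q = n0 + 2"
  define m where "m = k * (2 * q)"
  have "q \<le> k * q" using period_pos by simp
  then have m: "n0 + 2 \<le> m"
    unfolding m_def q_def using period_pos by simp
  define L where "L z = (C m * fst z + w m, C (Suc m) * snd z + w (Suc m))" for z
  have SF: "S q (F z) = L (S q z)" for z
    using aff[of m z] aff[of "Suc m" z] m by (simp add: S_def L_def m_def)
  have SF': "S (Suc q) (F z) = L (S (Suc q) z)" for z
  proof -
    define M where "M = k * (2 * Suc q)"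
    have M: "M = m + k * (2 * 1)" by (simp add: m_def M_def)
    then have "C M = C m" "C (Suc M) = C (Suc m)"
      using C_per[of m k] C_per[of "Suc m" k] m by (simp_all add: mult.commute)
    moreover have "w M = w m" "w (Suc M) = w (Suc m)"
      using w_per[of "m - 1" 1] w_per[of m 1] m by (simp_all add: M)
    moreover have "S (Suc q) x = (\<xi> x M, \<xi> x (Suc M))" for x
      by (simp only: S_def M_def)
    ultimately show ?thesis
      using aff[of M z] aff[of "Suc M" z] m M by (simp add: L_def)
  qed
  \<comment> \<open>L describes the action of F after q and also after q + 1 double periods;
    surjectivity of S q turns this into commutation of L with S 1.\<close>
  have comm: "S 1 (L y) = L (S 1 y)" for y
  proof -
    obtain z where "\<xi> z (k * (2 * q)) = fst y" "\<xi> z (Suc (k * (2 * q))) = snd y"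
      using surj_orbit_pair by blast
    then have z: "S q z = y" by (simp add: S_def)
    have "S 1 (S q (F z)) = L (S 1 (S q z))"
      using SF'[of z] S_add[of 1 q] by simp
    then show ?thesis by (simp add: SF z)
  qed
  have comm': "S i (L y) = L (S i y)" for i y
  proof (induction i)
    case (Suc i)
    then show ?case
      using S_add[of 1 i] comm by simp
  qed (simp add: S_def)
  have "F z = L z" for z
  \<comment> \<open>Commutation gives S q o F = L o S q = S q o L, and S q is injective.\<close>
  proof (rule inj_orbit_pair)
    have "S q (F z) = S q (L z)" by (simp add: SF comm')
    then show "\<xi> (F z) (k * (2 * q)) = \<xi> (L z) (k * (2 * q))"
      "\<xi> (F z) (Suc (k * (2 * q))) = \<xi> (L z) (Suc (k * (2 * q)))"
      by (simp_all add: S_def)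
  qed
  then show ?thesis
    using \<kappa> by (auto simp: L_def)
qed

end

subsection \<open>Automorphisms of a sublevel set\<close>

context periodic_henon_sequence
begin

text \<open>On large values of G, H acts as multiplication by d and F as the affine map of the line
  with slope A fixing c. Their commutator B is therefore a translation of the values, and by
  rigidity it is trivial, which leaves A = 1.\<close>

theorem level_automorphism_affine:
  assumes F: "polynomial_automorphism2 F" and c: "c > 0" and image: "F ` {z. green z < c} = {z. green z < c}"
  shows "\<exists>\<alpha> \<beta> f g. \<forall>x y. F (x, y) = (\<alpha> * x + f, \<beta> * y + g)"
proof -
  define d where "d = D k"
  have "2 ^ 1 \<le> (2 :: nat) ^ k"
    using period_pos by (intro power_increasing) auto
  then have d: "2 \<le> d"
    using D_ge_power[of k] by (simp add: d_def)
  have bij: "bij F" and pF: "polynomial_map2 F" and pF': "polynomial_map2 (inv F)"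
    using F by (auto simp: polynomial_automorphism2_def)
  have FF: "F (inv F z) = z" "inv F (F z) = z" for z
    using bij by (simp_all add: bij_is_surj surj_f_inv_f bij_is_inj inv_f_f)
  have lt: "green (F z) < c \<longleftrightarrow> green z < c" for z
  proof -
    have "F z \<in> F ` {z. green z < c} \<longleftrightarrow> z \<in> {z. green z < c}"
      by (rule inj_image_mem_iff[OF bij_is_inj[OF bij]])
    then show ?thesis unfolding image by simp
  qed
  have lt': "green (inv F z) < c \<longleftrightarrow> green z < c" for z
    using lt[of "inv F z"] by (simp add: FF)
  obtain A where A: "A > 0" "\<And>z. c < green z \<Longrightarrow> green (F z) - c = A * (green z - c)"
    using green_affine_relation[OF pF bij_is_inj[OF bij] c] lt by (force simp: not_less[symmetric])
  \<comment> \<open>The relation for the inverse provides the strict inequality c < G (F^(-1) z);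
    invariance of the sublevel set by itself gives the weak one.\<close>
  obtain A' where A': "A' > 0" "\<And>z. c < green z \<Longrightarrow> green (inv F z) - c = A' * (green z - c)"
    using green_affine_relation[OF pF' bij_is_inj[OF bij_imp_bij_inv[OF bij]] c] lt' by (force simp: not_less[symmetric])
  define H where "H z = (\<xi> z k, \<xi> z (Suc k))" for z
  have gH: "green (H z) = d * green z" for z
    using green_shift[of z 1] by (simp add: H_def d_def)
  have pH: "polynomial_map2 H"
    using polynomial_function2_orbit by (simp add: polynomial_map2_def comp_def H_def)
  have injH: "inj H"
    by (rule injI, rule inj_orbit_pair[of _ k]) (simp_all add: H_def)
  obtain H' where pH': "polynomial_map2 H'" and HH': "\<And>z. H (H' z) = z"
    using polynomial_right_inverse_orbit[of k] by (auto simp: H_def)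
  define B where "B z = H (F (H' (inv F z)))" for z
  have pB: "polynomial_map2 B"
    unfolding B_def by (intro polynomial_map2_compose[OF pH] polynomial_map2_compose[OF pF]
        polynomial_map2_compose[OF pH'] pF')
  have injB: "inj B"
  proof (rule injI)
    fix z z' assume "B z = B z'"
    then have "H' (inv F z) = H' (inv F z')"
      unfolding B_def by (metis FF(2) injD[OF injH])
    then show "z = z'"
      by (metis FF(1) HH')
  qed
  \<comment> \<open>The threshold ensures G (F^(-1) z) > d c + c, so that the value is still above c
    after division by d and the relation for F applies again.\<close>
  have relB: "green (B z) = green z + (d - 1) * (1 - A) * c" if z: "c + A * d * c < green z" for z
  proof -
    define a where "a = inv F z"
    have "0 < A * d * c" using A(1) c d by simp
    with z have "c < green z" by linarith
    then have "c < green a"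
      using A'(2)[of z] A'(1) mult_pos_pos[of A' "green z - c"] unfolding a_def by linarith
    then have ga: "green z - c = A * (green a - c)"
      using A(2)[of a] by (simp add: a_def FF)
    then have "A * (d * c) < A * (green a - c)"
      using z by (simp add: mult.assoc)
    then have "d * c < green a - c"
      using A(1) by simp
    then have "d * c < green a" using c by linarith
    moreover have "d * green (H' a) = green a"
      using gH[of "H' a"] by (simp add: HH')
    ultimately have "d * c < d * green (H' a)" by simp
    then have "c < green (H' a)" using d by simp
    then have e: "green (F (H' a)) = c + A * (green (H' a) - c)"
      using A(2) by (simp add: algebra_simps)
    have "d * green (F (H' a)) = d * c + A * (d * green (H' a)) - A * d * c"
      unfolding e by (simp add: algebra_simps)
    also have "\<dots> = d * c + A * green a - A * d * c"
      using \<open>d * green (H' a) = green a\<close> by simp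
    also have "\<dots> = green z + (d - 1) * (1 - A) * c"
      using ga d by (simp add: algebra_simps of_nat_diff)
    finally show ?thesis
      by (simp add: B_def gH a_def)
  qed
  have "(d - 1) * (1 - A) * c = 0"
    using green_translation_rigid[OF pB injB relB] by simp
  then have "A = 1"
    using d c by simp
  then have "green (F z) = green z + 0" if "c < green z" for z
    using A(2)[OF that] by simp
  from green_translation_rigid[OF pF bij_is_inj[OF bij] this] show ?thesis by simp
qed

end

section \<open>Henon maps as periodic sequences\<close>

definition henon_poly :: "(complex poly \<times> complex) list \<Rightarrow> nat \<Rightarrow> complex poly" where
  "henon_poly hs n = fst (hs ! (n mod length hs))"

definition henon_delta :: "(complex poly \<times> complex) list \<Rightarrow> nat \<Rightarrow> complex" where
  "henon_delta hs n = snd (hs ! (n mod length hs))"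

lemma henon_map_eq_orbit:
  "henon_map hs z = (henon_orbit (henon_poly hs) (henon_delta hs) z (length hs),
    henon_orbit (henon_poly hs) (henon_delta hs) z (Suc (length hs)))"
proof -
  let ?\<xi> = "henon_orbit (henon_poly hs) (henon_delta hs) z"
  have "henon_map (take n hs) z = (?\<xi> n, ?\<xi> (Suc n))" if "n \<le> length hs" for n
    using that
  proof (induction n)
    case (Suc n)
    then have "take (Suc n) hs = take n hs @ [hs ! n]" "n mod length hs = n"
      by (auto simp: take_Suc_conv_app_nth)
    with Suc show ?case
      by (simp add: henon_map_def elementary_henon_def henon_orbit.simps(3) henon_poly_def
          henon_delta_def split: prod.split)
  qed (simp add: henon_map_def)
  from this[of "length hs"] show ?thesis by simp
qed

lemma henon_data_imp_henon_sequence: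
  assumes "henon_data hs"
  shows "\<exists>R K. periodic_henon_sequence (henon_poly hs) (henon_delta hs) R K (length hs)"
proof -
  have ne: "hs \<noteq> []" using assms by (simp add: henon_data_def)
  have mem: "(henon_poly hs n, henon_delta hs n) \<in> set hs" for n
    using ne by (simp add: henon_poly_def henon_delta_def)
  have data: "2 \<le> degree p" "\<delta> \<noteq> 0" if "(p, \<delta>) \<in> set hs" for p \<delta>
    using assms that by (auto simp: henon_data_def)
  have "\<forall>h\<in>set hs. \<exists>R K. 1 \<le> R \<and> 0 \<le> K \<and> (\<forall>x y. R \<le> norm y \<longrightarrow> norm x \<le> norm y \<longrightarrow>
           2 * norm y \<le> norm (poly (fst h) y - snd h * x) \<and>
           \<bar>ln (norm (poly (fst h) y - snd h * x)) - degree (fst h) * ln (norm y) - ln (norm (lead_coeff (fst h)))\<bar>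
             \<le> K / norm y)"
    using henon_step_growth data by (metis prod.collapse)
  then obtain R K where RK: "\<And>h. h \<in> set hs \<Longrightarrow> 1 \<le> R h \<and> 0 \<le> K h \<and> (\<forall>x y. R h \<le> norm y \<longrightarrow> norm x \<le> norm y \<longrightarrow>
           2 * norm y \<le> norm (poly (fst h) y - snd h * x) \<and>
           \<bar>ln (norm (poly (fst h) y - snd h * x)) - degree (fst h) * ln (norm y) - ln (norm (lead_coeff (fst h)))\<bar>
             \<le> K h / norm y)"
    by metis
  define l where "l h = \<bar>ln (norm (lead_coeff (fst h)))\<bar>" for h :: "complex poly \<times> complex"
  \<comment> \<open>Sums of nonnegative constants over the finitely many factors serve as common
    upper bounds.\<close>
  define R' where "R' = 1 + (\<Sum>h\<in>set hs. R h)"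
  define K' where "K' = (\<Sum>h\<in>set hs. K h) + (\<Sum>h\<in>set hs. l h)"
  have R': "R h \<le> R'" if "h \<in> set hs" for h
    using member_le_sum[of h "set hs" R] RK that by (force simp: R'_def)
  have "0 \<le> l h" for h by (simp add: l_def)
  then have K': "K h \<le> K'" "l h \<le> K'" if "h \<in> set hs" for h
    using member_le_sum[of h "set hs" K] member_le_sum[of h "set hs" l] RK that
      sum_nonneg[of "set hs" K] sum_nonneg[of "set hs" l] by (force simp: K'_def)+
  have "periodic_henon_sequence (henon_poly hs) (henon_delta hs) R' K' (length hs)"
  proof
    fix n :: nat and x y :: complex and M :: real
    let ?h = "(henon_poly hs n, henon_delta hs n)"
    show "2 \<le> degree (henon_poly hs n)" "henon_delta hs n \<noteq> 0"
      using data[OF mem] by auto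
    show "1 \<le> R'" "0 \<le> K'"
      using R'[OF mem] K'[OF mem] RK[OF mem] by (meson order_trans)+
    show "\<bar>ln (norm (lead_coeff (henon_poly hs n)))\<bar> \<le> K'"
      using K'(2)[OF mem, of n] by (simp add: l_def)
    {
      assume y: "R' \<le> norm y" and x: "norm x \<le> norm y"
      have "R ?h \<le> norm y" using R'[OF mem] y order_trans by blast
      with x RK[OF mem, of n] have *: "2 * norm y \<le> norm (poly (henon_poly hs n) y - henon_delta hs n * x)"
        "\<bar>ln (norm (poly (henon_poly hs n) y - henon_delta hs n * x)) - degree (henon_poly hs n) * ln (norm y)
          - ln (norm (lead_coeff (henon_poly hs n)))\<bar> \<le> K ?h / norm y"
        by auto
      show "2 * norm y \<le> norm (poly (henon_poly hs n) y - henon_delta hs n * x)" by (rule *(1))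
      have "K ?h / norm y \<le> K' / norm y"
        using K'(1)[OF mem] by (simp add: divide_right_mono)
      with *(2) show "\<bar>ln (norm (poly (henon_poly hs n) y - henon_delta hs n * x)) - degree (henon_poly hs n) * ln (norm y)
          - ln (norm (lead_coeff (henon_poly hs n)))\<bar> \<le> K' / norm y"
        by linarith
    }
    define B where "B h = (\<Sum>i\<le>degree (fst h). norm (coeff (fst h) i) * \<bar>M\<bar> ^ i) + norm (snd h) * \<bar>M\<bar>"
      for h :: "complex poly \<times> complex"
    have B0: "0 \<le> B h" for h by (auto simp: B_def intro!: add_nonneg_nonneg sum_nonneg)
    have "norm (poly (henon_poly hs n) y - henon_delta hs n * x) \<le> (\<Sum>h\<in>set hs. B h)"
      if "norm x \<le> M" "norm y \<le> M" for n x y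
    proof -
      have "norm (poly (henon_poly hs n) y - henon_delta hs n * x)
        \<le> norm (poly (henon_poly hs n) y) + norm (henon_delta hs n * x)"
        by (rule norm_triangle_ineq4)
      also have "\<dots> \<le> B (henon_poly hs n, henon_delta hs n)"
        unfolding B_def fst_conv snd_conv norm_mult
        using that by (intro add_mono norm_poly_le_of_norm_le mult_left_mono) auto
      also have "\<dots> \<le> (\<Sum>h\<in>set hs. B h)"
        by (rule member_le_sum[OF mem]) (auto simp: B0)
      finally show ?thesis .
    qed
    then show "\<exists>C. \<forall>n x y. norm x \<le> M \<longrightarrow> norm y \<le> M \<longrightarrow>
        norm (poly (henon_poly hs n) y - henon_delta hs n * x) \<le> C"
      by blast
    show "0 < length hs" using ne by simp
    show "henon_poly hs (n + length hs) = henon_poly hs n" "henon_delta hs (n + length hs) = henon_delta hs n"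
      by (simp_all add: henon_poly_def henon_delta_def)
  qed
  then show ?thesis by blast
qed

text \<open>The terms defining \<open>green_plus\<close> are the levels at the multiples of k, a
  subsequence of a convergent sequence.\<close>

lemma (in periodic_henon_sequence) green_plus_eq_green:
  assumes "p = henon_poly hs" "\<delta> = henon_delta hs" "k = length hs"
  shows "green_plus hs = green"
proof
  fix z
  have orbit: "(henon_map hs ^^ q) z = (\<xi> z (k * q), \<xi> z (Suc (k * q)))" for q
  proof (induction q)
    case (Suc q)
    have "(henon_map hs ^^ Suc q) z = henon_map hs (\<xi> z (k * q), \<xi> z (Suc (k * q)))"
      using Suc by simp
    also have "\<dots> = (\<xi> z (k + k * q), \<xi> z (Suc k + k * q))"
      unfolding henon_map_eq_orbit orbit_shift[of z k q] orbit_shift[of z "Suc k" q] by (simp add: assms)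
    finally show ?case by simp
  qed simp
  have "D k = (\<Prod>i<k. degree (p i))"
    by (rule D_def)
  also have "\<dots> = (\<Prod>i<length hs. degree (fst (hs ! i)))"
    using assms by (simp add: henon_poly_def)
  finally have deg: "henon_degree hs = D k"
    by (simp add: henon_degree_def prod.list_conv_set_nth atLeast0LessThan split_beta)
  have pow: "D k ^ q = D (k * q)" for q
  proof (induction q)
    case (Suc q)
    then show ?case using D_shift[of k q] by simp
  qed simp
  have "green_plus hs z = lim (\<lambda>q. level (k * q) z)"
    by (simp add: green_plus_def orbit deg level_def flip: pow)
  moreover have "(\<lambda>q. level (k * q) z) \<longlonglongrightarrow> green z"
    using LIMSEQ_subseq_LIMSEQ[OF level_tendsto_green, of "\<lambda>q. k * q"] period_pos
    by (simp add: comp_def strict_mono_def)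
  ultimately show "green_plus hs z = green z"
    by (simp add: limI)
qed

theorem proposition1p4:
  fixes hs :: "(complex poly \<times> complex) list"
    and c :: real
    and F :: "complex \<times> complex \<Rightarrow> complex \<times> complex"
  assumes "henon_data hs"
    and "c > 0"
    and "polynomial_automorphism2 F"
    and "F ` henon_sublevel hs c = henon_sublevel hs c"
  shows "affine_automorphism2 F \<and>
    (\<exists>a b d f g :: complex. F = (\<lambda>(x, y). (a * x + b * y + f, d * y + g)))"
proof -
  obtain R K where "periodic_henon_sequence (henon_poly hs) (henon_delta hs) R K (length hs)"
    using henon_data_imp_henon_sequence[OF assms(1)] by blast
  then interpret periodic_henon_sequence "henon_poly hs" "henon_delta hs" R K "length hs" .
  have "F ` {z. green z < c} = {z. green z < c}"
    using assms(4) by (simp add: henon_sublevel_def green_plus_eq_green)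
  then obtain \<alpha> \<beta> f g where "\<And>x y. F (x, y) = (\<alpha> * x + f, \<beta> * y + g)"
    using level_automorphism_affine[OF assms(3,2)] by blast
  \<comment> \<open>The linear part is diagonal, so the shear coefficient b is taken to be
    0.\<close>
  then have F: "F = (\<lambda>(x, y). (\<alpha> * x + 0 * y + f, 0 * x + \<beta> * y + g))"
    by (auto simp: fun_eq_iff)
  have "bij F"
    using assms(3) by (simp add: polynomial_automorphism2_def)
  then have "affine_automorphism2 F"
    unfolding affine_automorphism2_def using F by blast
  moreover have "F = (\<lambda>(x, y). (\<alpha> * x + 0 * y + f, \<beta> * y + g))"
    using F by simp
  ultimately show ?thesis by blast
qed

end
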